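(* Let $\gamma\in(0,2)$, let $K_0>0$, and let $L:(0,\infty)\to(0,\infty)$ be a measurable function slowly varying at infinity. Define $$C(\gamma)=\frac{\Gamma(1+\gamma)\sin\left(\frac{\gamma\pi}{2}\right)}{\pi(2-\gamma)}.$$ Then the following are equivalent: (i) $G(x)\sim C(\gamma)K_0\,x^{2-\gamma}L(1/x)$ as $x\to0^+$; (ii) $\operatorname{Var}(S_n)\sim K_0\,n^{\gamma}L(n)$ as $n\to\infty$. In particular, $\operatorname{Var}(S_n)/n\to K_0$ as $n\to\infty$ if and only if $G(x)/x\to K_0/\pi$ as $x\to0^+$.
   Context: Let $X_1,X_2,\ldots$ be a sequence of centred, weakly stationary, real random variables with finite second moments. Its spectral measure is the finite Borel measure $F$ on $[-\pi,\pi]$ such that $r_k:=\operatorname{Cov}(X_0,X_k)=\int_{-\pi}^{\pi}e^{\mathrm{i}tk}\,F(\mathrm{d}t)$ for all integers $k$; it is assumed that $F$ is symmetric about the origin. Define $G(x)=F([-x,x])$ for $0\le x\le\pi$, and $S_n=X_1+\cdots+X_n$. A positive measurable function $L$ is slowly varying at infinity if $L(\lambda x)/L(x)\to1$ as $x\to\infty$ for every $\lambda>0$. The notation $a\sim b$ means $a/b\to1$. *)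

theory Defs
  imports "HOL-Probability.Probability" "HOL-Library.Landau_Symbols"
begin

definition covariance :: "'a measure \<Rightarrow> ('a \<Rightarrow> real) \<Rightarrow> ('a \<Rightarrow> real) \<Rightarrow> real" where
  "covariance M X Y =
     integral\<^sup>L M (\<lambda>\<omega>. (X \<omega> - integral\<^sup>L M X) * (Y \<omega> - integral\<^sup>L M Y))"

definition spec_coeff :: "real measure \<Rightarrow> int \<Rightarrow> complex" where
  "spec_coeff F k = (CLINT t|F. exp (\<i> * complex_of_real t * of_int k))"

definition specG :: "real measure \<Rightarrow> real \<Rightarrow> real" where
  "specG F x = measure F {-x..x}"

definition slowly_varying :: "(real \<Rightarrow> real) \<Rightarrow> bool" where
  "slowly_varying L \<longleftrightarrow> (\<forall>x>0. L x > 0) \<and>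
     (\<forall>c>0. ((\<lambda>x. L (c * x) / L x) \<longlongrightarrow> 1) at_top)"

definition Cgamma :: "real \<Rightarrow> real" where
  "Cgamma \<gamma> = Gamma (1 + \<gamma>) * sin (\<gamma> * pi / 2) / (pi * (2 - \<gamma>))"

end

theory Submission
  imports Defs "HOL-Real_Asymp.Real_Asymp"
begin

text \<open>
  Write \<open>V n = Var (S n) = \<integral> sin\<^sup>2 (n t / 2) / sin\<^sup>2 (t / 2) dF\<close> and \<open>P x = \<integral> 1 / (x\<^sup>2 + t\<^sup>2) dF\<close>.

  Tauberian direction.  Summing the Fejer kernel against \<open>exp (- \<delta> n)\<close> gives
  \<open>coth (\<delta> / 2) \<integral> 1 / (4 sinh\<^sup>2 (\<delta> / 2) + 4 sin\<^sup>2 (t / 2)) dF\<close>, which is \<open>2 P \<delta> / \<delta>\<close> up to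
  lower order terms.  The Abelian theorem for Laplace sums (via the uniform convergence theorem
  and Potter bounds for \<open>L\<close>) therefore turns the asymptotics of \<open>V\<close> into
  \<open>P x \<sim> (K / 2) \<Gamma> (1 + \<gamma>) x powr (- \<gamma>) L (1 / x)\<close>.  Consider the law of
  \<open>u = x\<^sup>2 / (x\<^sup>2 + t\<^sup>2)\<close> under the probability measure proportional to \<open>dF / (x\<^sup>2 + t\<^sup>2)\<close>.  Since
  \<open>\<integral> 1 / (1 + a u) = P (sqrt (1 + a) x) / P x \<longlongrightarrow> (1 + a) powr (- \<gamma> / 2)\<close>, its moments converge to those
  of the Beta distribution with parameters \<open>\<gamma> / 2, 1 - \<gamma> / 2\<close>, and testing this weak limit against
  \<open>u \<mapsto> 1 / u\<close> on \<open>u \<ge> 1/2\<close> gives the limit of \<open>G x / (x\<^sup>2 P x)\<close>.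

  Abelian direction.  From \<open>P x = \<integral> G y \<cdot> 2 y / (x\<^sup>2 + y\<^sup>2)\<^sup>2 dy\<close> regular variation passes from \<open>G\<close> to
  \<open>P\<close>, so the same weak limit holds; testing it against the Fejer kernel, which differs from its
  scale-invariant version \<open>4 sin\<^sup>2 (n t / 2) / t\<^sup>2\<close> by \<open>O(1)\<close>, yields \<open>V n \<sim> D n powr \<gamma> L n\<close>.
\<close>

section \<open>Slowly varying functions\<close>

text \<open>Additive form of the uniform convergence theorem. For late \<open>y\<close> the set of
  bad increments in \<open>{0..2*T}\<close> is small by dominated convergence, so some
  \<open>v\<close> is good as seen from both \<open>y\<close> and \<open>y + c\<close>; comparing
  both values with \<open>h (y + v)\<close> costs \<epsilon>/2 each.\<close>

lemma increments_tend_to_zero_uniformly: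
  fixes h :: "real \<Rightarrow> real"
  assumes h [measurable]: "h \<in> borel_measurable borel"
    and lim: "\<And>u. ((\<lambda>y. h (y + u) - h y) \<longlongrightarrow> 0) at_top"
    and "0 < T" "0 < \<epsilon>"
  shows "\<exists>Y. \<forall>y\<ge>Y. \<forall>c\<in>{0..T}. \<bar>h (y + c) - h y\<bar> < \<epsilon>"
proof -
  define A where "A y = {u \<in> {0..2*T}. \<epsilon> / 2 \<le> \<bar>h (y + u) - h y\<bar>}" for y
  have A_sets [measurable]: "A y \<in> sets borel" for y
    unfolding A_def by measurable
  have A_fin: "emeasure lborel (A y) < \<infinity>" for y
  proof -
    have "emeasure lborel (A y) \<le> emeasure lborel {0..2*T}"
      by (rule emeasure_mono) (auto simp: A_def)
    also have "\<dots> < \<infinity>" using \<open>0 < T\<close> by simp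
    finally show ?thesis .
  qed
  have "((\<lambda>y. integral\<^sup>L lborel (indicat_real (A y))) \<longlongrightarrow> integral\<^sup>L lborel (\<lambda>_::real. 0::real)) at_top"
  proof (rule integral_dominated_convergence_at_top[where s = "\<lambda>y. indicat_real (A y)" and w = "indicat_real {0..2*T}"])
    show "\<forall>\<^sub>F y in at_top. AE u in lborel. norm (indicat_real (A y) u) \<le> indicat_real {0..2*T} u"
      by (auto simp: A_def indicator_def)
    show "AE u in lborel. ((\<lambda>y. indicat_real (A y) u) \<longlongrightarrow> 0) at_top"
    proof (rule AE_I2)
      fix u
      have "\<forall>\<^sub>F y in at_top. \<bar>h (y + u) - h y\<bar> < \<epsilon> / 2"
        using tendstoD[OF lim[of u], of "\<epsilon> / 2"] \<open>0 < \<epsilon>\<close> by simp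
      then have "\<forall>\<^sub>F y in at_top. indicat_real (A y) u = 0"
        by eventually_elim (auto simp: A_def)
      then show "((\<lambda>y. indicat_real (A y) u) \<longlongrightarrow> 0) at_top"
        by (rule tendsto_eventually)
    qed
    show "integrable lborel (indicat_real {0..2*T})"
      using \<open>0 < T\<close> by (intro integrable_real_indicator) auto
  qed auto
  then have "((\<lambda>y. measure lborel (A y)) \<longlongrightarrow> 0) at_top" by simp
  from order_tendstoD(2)[OF this, of "T/2"] obtain Y where Y: "\<And>y. Y \<le> y \<Longrightarrow> measure lborel (A y) < T/2"
    using \<open>0 < T\<close> by (auto simp: eventually_at_top_linorder)
  have "\<bar>h (y + c) - h y\<bar> < \<epsilon>" if y: "Y \<le> y" and c: "c \<in> {0..T}" for y c
  proof -
    \<comment> \<open>The bad set at \<open>y + c\<close>, moved so that its increments are measured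
      from \<open>y\<close>; translation preserves its measure.\<close>
    define B where "B = (+) c ` A (y + c)"
    have B_eq: "B = (\<lambda>u. u - c) -` A (y + c) \<inter> space lborel"
      unfolding B_def by (auto simp: image_iff intro!: bexI[of _ "_ - c"])
    have B_sets [measurable]: "B \<in> sets borel"
      unfolding B_eq by measurable
    have Bm: "emeasure lborel B = emeasure lborel (A (y + c))"
    proof -
      have "emeasure lborel B = emeasure (distr lborel borel ((+) c)) B"
        by (simp add: lborel_distr_plus)
      also have "\<dots> = emeasure lborel ((+) c -` B \<inter> space lborel)"
        by (rule emeasure_distr) auto
      also have "(+) c -` B \<inter> space lborel = A (y + c)"
        by (auto simp: B_def)
      finally show ?thesis .
    qed
    have "measure lborel (A y \<union> B) \<le> measure lborel (A y) + measure lborel B"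
      by (rule measure_Un_le) auto
    also have "measure lborel B = measure lborel (A (y + c))"
      using Bm by (simp add: measure_def)
    also have "measure lborel (A y) + \<dots> < T"
      using Y[of y] Y[of "y + c"] y c by auto
    finally have small: "measure lborel (A y \<union> B) < T" .
    \<comment> \<open>The window has length 2T so that, after increments below \<open>c\<close> are
      discarded, length at least \<open>T\<close> remains, more than the two bad sets can
      cover.\<close>
    have "\<not> {c..2*T} \<subseteq> A y \<union> B"
    proof
      assume sub: "{c..2*T} \<subseteq> A y \<union> B"
      have "measure lborel {c..2*T} \<le> measure lborel (A y \<union> B)"
      proof (rule measure_mono_fmeasurable[OF sub])
        show "A y \<union> B \<in> fmeasurable lborel"
          using A_fin[of y] A_fin[of "y + c"] Bm by (intro fmeasurable.Un) (auto simp: fmeasurable_def)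
      qed simp
      then show False using small c by auto
    qed
    then obtain v where v: "v \<in> {c..2*T}" "v \<notin> A y" "v \<notin> B" by blast
    have "v - c \<notin> A (y + c)" using v(3) by (auto simp: B_eq)
    then have "\<bar>h (y + v) - h (y + c)\<bar> < \<epsilon> / 2"
      using v c by (auto simp: A_def algebra_simps)
    moreover have "\<bar>h (y + v) - h y\<bar> < \<epsilon> / 2"
      using v c by (auto simp: A_def)
    ultimately show ?thesis by linarith
  qed
  then show ?thesis by blast
qed

text \<open>Chain steps of length at most 1. Their number is at most the distance plus 1, whence the
  \<open>+ 1\<close>.\<close>

lemma increments_sublinear:
  fixes h :: "real \<Rightarrow> real"
  assumes step: "\<And>y c. Y \<le> y \<Longrightarrow> c \<in> {0..1} \<Longrightarrow> \<bar>h (y + c) - h y\<bar> < \<epsilon>"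
    and "Y \<le> x" "Y \<le> y"
  shows "\<bar>h y - h x\<bar> \<le> \<epsilon> * (\<bar>y - x\<bar> + 1)"
proof -
  have eps: "\<epsilon> > 0" using step[of Y 0] by simp
  have main: "\<bar>h (x + c) - h x\<bar> \<le> \<epsilon> * real (Suc n)"
    if "Y \<le> x" "0 \<le> c" "c \<le> real (Suc n)" for x c n
    using that
  proof (induction n arbitrary: c)
    case 0
    then show ?case using step[of x c] by auto
  next
    case (Suc n)
    show ?case
    proof (cases "c \<le> 1")
      case True
      then have "\<bar>h (x + c) - h x\<bar> < \<epsilon>" using step[of x c] Suc.prems by auto
      also have "\<epsilon> \<le> \<epsilon> * real (Suc (Suc n))" using eps by simp
      finally show ?thesis by simp
    next
      case False
      have "\<bar>h (x + (c - 1)) - h x\<bar> \<le> \<epsilon> * real (Suc n)"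
        using Suc.prems False by (intro Suc.IH) auto
      moreover have "\<bar>h ((x + (c - 1)) + 1) - h (x + (c - 1))\<bar> < \<epsilon>"
        using Suc.prems False by (intro step) auto
      ultimately show ?thesis by (simp add: algebra_simps) 
    qed
  qed
  have ordered: "\<bar>h y - h x\<bar> \<le> \<epsilon> * (\<bar>y - x\<bar> + 1)" if "Y \<le> x" "x \<le> y" for x y
  proof -
    have "\<bar>h (x + (y - x)) - h x\<bar> \<le> \<epsilon> * real (Suc (nat \<lfloor>y - x\<rfloor>))"
      using that by (intro main) (auto, linarith)
    also have "\<dots> \<le> \<epsilon> * (\<bar>y - x\<bar> + 1)"
      using that eps by (intro mult_left_mono) auto
    finally show ?thesis by simp
  qed
  show ?thesis
    using ordered[of x y] ordered[of y x] assms(2,3) by (cases "x \<le> y") (auto simp: abs_minus_commute)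
qed

section \<open>Slow variation in logarithmic coordinates, and Potter bounds\<close>

lemma slowly_varying_pos: "slowly_varying L \<Longrightarrow> x > 0 \<Longrightarrow> L x > 0"
  by (simp add: slowly_varying_def)

context
  fixes L :: "real \<Rightarrow> real"
  assumes L_meas: "L \<in> borel_measurable (restrict_space borel {0<..})"
    and L_sv: "slowly_varying L"
begin

lemma slowly_varying_ln_exp_measurable: "(\<lambda>y. ln (L (exp y))) \<in> borel_measurable borel"
proof -
  have "exp \<in> measurable borel (restrict_space borel {0::real<..})"
    by (rule measurable_restrict_space2) auto
  from measurable_compose[OF this L_meas] show ?thesis
    by (intro borel_measurable_ln) simp
qed

text \<open>With \<open>h y = ln (L (exp y))\<close> a multiplicative ratio becomes an additive
  increment, the form treated above.\<close>

lemma slowly_varying_ln_exp_increment: "((\<lambda>y. ln (L (exp (y + u))) - ln (L (exp y))) \<longlongrightarrow> 0) at_top"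
proof -
  have "((\<lambda>x. L (exp u * x) / L x) \<longlongrightarrow> 1) at_top"
    using L_sv by (simp add: slowly_varying_def)
  from filterlim_compose[OF this exp_at_top]
  have "((\<lambda>y. ln (L (exp u * exp y) / L (exp y))) \<longlongrightarrow> ln 1) at_top"
    by (intro tendsto_ln) auto
  moreover have "ln (L (exp u * exp y) / L (exp y)) = ln (L (exp (y + u))) - ln (L (exp y))" for y
    using slowly_varying_pos[OF L_sv, of "exp u * exp y"] slowly_varying_pos[OF L_sv, of "exp y"]
    by (simp add: ln_div exp_add mult.commute)
  ultimately show ?thesis by simp
qed

text \<open>Two consequences with one threshold: closeness on unit windows serves asymptotically
  equal arguments, sublinear growth serves the Potter bounds.\<close>

lemma slowly_varying_uniform:
  assumes "\<epsilon> > 0"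
  obtains Y where "\<And>x y. Y \<le> x \<Longrightarrow> Y \<le> y \<Longrightarrow> \<bar>y - x\<bar> \<le> 1 \<Longrightarrow> \<bar>ln (L (exp y)) - ln (L (exp x))\<bar> < \<epsilon>"
    and "\<And>x y. Y \<le> x \<Longrightarrow> Y \<le> y \<Longrightarrow> \<bar>ln (L (exp y)) - ln (L (exp x))\<bar> \<le> \<epsilon> * (\<bar>y - x\<bar> + 1)"
proof -
  from increments_tend_to_zero_uniformly[OF slowly_varying_ln_exp_measurable slowly_varying_ln_exp_increment zero_less_one assms]
  obtain Y where Y: "\<And>y c. Y \<le> y \<Longrightarrow> c \<in> {0..1} \<Longrightarrow> \<bar>ln (L (exp (y + c))) - ln (L (exp y))\<bar> < \<epsilon>"
    by blast
  have "\<bar>ln (L (exp y)) - ln (L (exp x))\<bar> < \<epsilon>" if "Y \<le> x" "Y \<le> y" "\<bar>y - x\<bar> \<le> 1" for x y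
  proof (cases "x \<le> y")
    case True then show ?thesis using Y[of x "y - x"] that by auto
  next
    case False then show ?thesis using Y[of y "x - y"] that by (auto simp: abs_minus_commute)
  qed
  moreover have "\<bar>ln (L (exp y)) - ln (L (exp x))\<bar> \<le> \<epsilon> * (\<bar>y - x\<bar> + 1)" if "Y \<le> x" "Y \<le> y" for x y
    using increments_sublinear[of Y "\<lambda>y. ln (L (exp y))", OF Y] that by auto
  ultimately show ?thesis using that by blast
qed

text \<open>Potter bound in exponential form:
  \<open>exp (\<epsilon> * \<bar>ln y - ln x\<bar>)\<close> is the larger of y/x and x/y raised to
  the power \<epsilon>, and \<open>exp \<epsilon>\<close> is the constant in front.\<close>

lemma slowly_varying_Potter:
  assumes "\<epsilon> > 0"
  obtains X where "X > 0"
    and "\<And>x y. X \<le> x \<Longrightarrow> X \<le> y \<Longrightarrow> L y \<le> exp (\<epsilon> * (\<bar>ln y - ln x\<bar> + 1)) * L x"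
proof -
  obtain Y where Y: "\<And>x y. Y \<le> x \<Longrightarrow> Y \<le> y \<Longrightarrow> \<bar>ln (L (exp y)) - ln (L (exp x))\<bar> \<le> \<epsilon> * (\<bar>y - x\<bar> + 1)"
    using slowly_varying_uniform[OF assms] by metis
  have "L y \<le> exp (\<epsilon> * (\<bar>ln y - ln x\<bar> + 1)) * L x" if "exp Y \<le> x" "exp Y \<le> y" for x y
  proof -
    have pos: "x > 0" "y > 0" using that exp_gt_zero[of Y] by linarith+
    have "ln (L y) \<le> \<epsilon> * (\<bar>ln y - ln x\<bar> + 1) + ln (L x)"
      using Y[of "ln x" "ln y"] that pos by (simp add: ln_ge_iff)
    then have "exp (ln (L y)) \<le> exp (\<epsilon> * (\<bar>ln y - ln x\<bar> + 1) + ln (L x))" by simp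
    then show ?thesis using slowly_varying_pos[OF L_sv] pos by (simp add: exp_add)
  qed
  then show ?thesis using that[of "exp Y"] by auto
qed

text \<open>The definition compares \<open>L\<close> only at constant multiples; uniformity over
  logarithmic windows extends this to arguments whose ratio merely tends to 1.\<close>

lemma slowly_varying_asymp_arg:
  assumes a: "filterlim a at_top Fl" and ba: "((\<lambda>x. b x / a x) \<longlongrightarrow> 1) Fl"
  shows "((\<lambda>x. L (b x) / L (a x)) \<longlongrightarrow> 1) Fl"
proof -
  have lnlim: "((\<lambda>x. ln (b x / a x)) \<longlongrightarrow> 0) Fl"
    using tendsto_ln[OF ba] by simp
  have "((\<lambda>x. ln (L (b x)) - ln (L (a x))) \<longlongrightarrow> 0) Fl"
  proof (rule tendstoI)
    fix \<epsilon> :: real assume "\<epsilon> > 0"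
    then obtain Y where Y: "\<And>x y. Y \<le> x \<Longrightarrow> Y \<le> y \<Longrightarrow> \<bar>y - x\<bar> \<le> 1 \<Longrightarrow> \<bar>ln (L (exp y)) - ln (L (exp x))\<bar> < \<epsilon>"
      using slowly_varying_uniform by metis
    \<comment> \<open>The extra 1 leaves room: \<open>ln (b x)\<close> lies within 1 of
      \<open>ln (a x)\<close> and so stays above \<open>Y\<close>.\<close>
    have e1: "\<forall>\<^sub>F x in Fl. a x \<ge> exp (Y + 1)"
      using a by (simp add: filterlim_at_top)
    have e2: "\<forall>\<^sub>F x in Fl. \<bar>ln (b x / a x)\<bar> < 1"
      using tendstoD[OF lnlim, of 1] by simp
    have e3: "\<forall>\<^sub>F x in Fl. b x / a x > 0"
      using order_tendstoD(1)[OF ba, of 0] by simp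
    show "\<forall>\<^sub>F x in Fl. dist (ln (L (b x)) - ln (L (a x))) 0 < \<epsilon>"
      using e1 e2 e3
    proof eventually_elim
      case (elim x)
      have pos: "a x > 0" using elim(1) exp_gt_zero[of "Y + 1"] by linarith
      then have posb: "b x > 0" using elim(3) by (simp add: zero_less_divide_iff)
      have "ln (a x) \<ge> Y + 1" using elim(1) pos by (simp add: ln_ge_iff)
      then show ?case
        using Y[of "ln (a x)" "ln (b x)"] elim(2) pos posb by (auto simp: ln_div)
    qed
  qed
  then have "((\<lambda>x. exp (ln (L (b x)) - ln (L (a x)))) \<longlongrightarrow> exp 0) Fl"
    by (rule tendsto_exp)
  moreover have "\<forall>\<^sub>F x in Fl. exp (ln (L (b x)) - ln (L (a x))) = L (b x) / L (a x)"
  proof -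
    have e1: "\<forall>\<^sub>F x in Fl. a x > 0"
      using a by (simp add: filterlim_at_top_dense)
    have e3: "\<forall>\<^sub>F x in Fl. b x / a x > 0"
      using order_tendstoD(1)[OF ba, of 0] by simp
    show ?thesis using e1 e3
      by eventually_elim (auto simp: exp_diff slowly_varying_pos[OF L_sv] zero_less_divide_iff)
  qed
  ultimately show ?thesis by (auto elim: Lim_transform_eventually)
qed

text \<open>By Potter with \<gamma>/2, \<open>L\<close> is at least a constant times
  \<open>x powr (- \<gamma>/2)\<close>, so half of the power survives. This growth later absorbs all
  bounded error terms.\<close>

lemma slowly_varying_powr_at_top:
  assumes "\<gamma> > 0"
  shows "filterlim (\<lambda>x. x powr \<gamma> * L x) at_top at_top"
proof -
  obtain X where X: "X > 0"
    "\<And>x y. X \<le> x \<Longrightarrow> X \<le> y \<Longrightarrow> L y \<le> exp (\<gamma>/2 * (\<bar>ln y - ln x\<bar> + 1)) * L x"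
    using slowly_varying_Potter[of "\<gamma>/2"] assms by auto
  define c where "c = L X * exp (\<gamma>/2 * (ln X - 1))"
  have c: "c > 0" using X(1) slowly_varying_pos[OF L_sv] by (simp add: c_def)
  have "\<forall>\<^sub>F x in at_top. c * x powr (\<gamma>/2) \<le> x powr \<gamma> * L x"
    using eventually_ge_at_top[of X]
  proof eventually_elim
    case (elim x)
    have pos: "x > 0" using elim X(1) by linarith
    have "c * x powr (\<gamma>/2) = L X * exp (\<gamma>/2 * (ln X - 1)) * exp (\<gamma>/2 * ln x)"
      using pos by (simp add: c_def powr_def)
    also have "\<dots> \<le> (exp (\<gamma>/2 * ((ln x - ln X) + 1)) * L x) * exp (\<gamma>/2 * (ln X - 1)) * exp (\<gamma>/2 * ln x)"
      using X(2)[of x X] elim X(1) pos by (intro mult_right_mono) (auto simp: abs_minus_commute)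
    also have "\<dots> = exp (\<gamma>/2 * ((ln x - ln X) + 1) + \<gamma>/2 * (ln X - 1) + \<gamma>/2 * ln x) * L x"
      by (simp only: exp_add mult_ac)
    also have "\<gamma>/2 * ((ln x - ln X) + 1) + \<gamma>/2 * (ln X - 1) + \<gamma>/2 * ln x = \<gamma> * ln x"
      by (simp add: field_simps)
    finally show ?case using pos by (simp add: powr_def)
  qed
  moreover have "filterlim (\<lambda>x. c * x powr (\<gamma>/2)) at_top at_top"
    using c assms by (intro filterlim_tendsto_pos_mult_at_top[OF tendsto_const]
        real_powr_at_top) auto
  ultimately show ?thesis by (rule filterlim_at_top_mono[rotated])
qed

end

section \<open>An Abelian theorem for Laplace sums\<close>

text \<open>As the integral of a step function, a Laplace sum can be rescaled by a real factor and
  handled by dominated convergence.\<close>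

lemma suminf_eq_integral_floor:
  fixes f :: "nat \<Rightarrow> real"
  assumes nonneg: "\<And>n. f n \<ge> 0" and "summable f"
  shows "(\<integral>x. indicator {0..} x * f (nat \<lfloor>x\<rfloor>) \<partial>(lborel :: real measure)) = suminf f"
proof -
  have "(\<integral>\<^sup>+x. ennreal (indicator {0..} x * f (nat \<lfloor>x\<rfloor>)) \<partial>(lborel :: real measure))
      = (\<integral>\<^sup>+x. (\<Sum>n. ennreal (f n) * indicator {real n..<real n + 1} x) \<partial>lborel)"
  proof (rule nn_integral_cong)
    fix x :: real
    have "(\<Sum>n. ennreal (f n) * indicator {real n..<real n + 1} x)
        = (\<Sum>n\<in>{nat \<lfloor>x\<rfloor>}. ennreal (f n) * indicator {real n..<real n + 1} x)"
    proof (rule suminf_finite)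
      fix n assume "n \<notin> {nat \<lfloor>x\<rfloor>}"
      then have "x \<notin> {real n..<real n + 1}" by (auto, linarith)
      then show "ennreal (f n) * indicator {real n..<real n + 1} x = 0" by simp
    qed simp
    also have "\<dots> = ennreal (indicator {0..} x * f (nat \<lfloor>x\<rfloor>))"
      by (auto simp: indicator_def)
    finally show "ennreal (indicator {0..} x * f (nat \<lfloor>x\<rfloor>))
        = (\<Sum>n. ennreal (f n) * indicator {real n..<real n + 1} x)" by simp
  qed
  also have "\<dots> = (\<Sum>n. \<integral>\<^sup>+x. ennreal (f n) * indicator {real n..<real n + 1} x \<partial>lborel)"
    by (rule nn_integral_suminf) simp
  also have "\<dots> = (\<Sum>n. ennreal (f n))"
    by (simp add: nn_integral_cmult_indicator)
  also have "\<dots> = ennreal (suminf f)"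
    using assms by (intro suminf_ennreal2) auto
  finally have "(\<integral>\<^sup>+x. ennreal (indicator {0..} x * f (nat \<lfloor>x\<rfloor>)) \<partial>(lborel :: real measure)) = ennreal (suminf f)" .
  then have "has_bochner_integral lborel (\<lambda>x::real. indicator {0..} x * f (nat \<lfloor>x\<rfloor>)) (suminf f)"
    using assms by (intro has_bochner_integral_nn_integral) (auto intro: suminf_nonneg)
  then show ?thesis by (rule has_bochner_integral_integral_eq)
qed

lemma has_bochner_integral_Gamma:
  assumes "a > (0::real)"
  shows "has_bochner_integral lborel (\<lambda>t. indicator {0..} t * t powr (a - 1) / exp t) (Gamma a)"
  using Gamma_conv_nn_integral_real[OF assms] Gamma_real_pos[OF assms]
  by (intro has_bochner_integral_nn_integral) auto

text \<open>Replaces a Potter factor by two powers, which lead to Gamma integrands.\<close>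

lemma exp_abs_ln_le:
  assumes "y > (0::real)"
  shows "exp (\<epsilon> * \<bar>ln y\<bar>) \<le> y powr \<epsilon> + y powr (- \<epsilon>)"
  using assms by (cases "ln y \<ge> 0") (auto simp: powr_def)

lemma filterlim_nat_floor_mult:
  assumes "y > (0::real)"
  shows "filterlim (\<lambda>X. nat \<lfloor>X * y\<rfloor>) sequentially at_top"
    and "((\<lambda>X. real (nat \<lfloor>X * y\<rfloor>) / (X * y)) \<longlongrightarrow> 1) at_top"
proof -
  have Xy: "filterlim (\<lambda>X. X * y) at_top at_top"
    using assms by (intro filterlim_at_top_mult_tendsto_pos[OF tendsto_const _ filterlim_ident])
  show "filterlim (\<lambda>X. nat \<lfloor>X * y\<rfloor>) sequentially at_top"
    by (rule filterlim_compose[OF filterlim_nat_sequentially filterlim_compose[OF filterlim_floor_sequentially Xy]])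
  have *: "((\<lambda>x::real. real (nat \<lfloor>x\<rfloor>) / x) \<longlongrightarrow> 1) at_top"
  proof (rule tendsto_sandwich)
    show "\<forall>\<^sub>F x::real in at_top. real (nat \<lfloor>x\<rfloor>) / x \<le> 1"
      using eventually_gt_at_top[of 0] by eventually_elim (simp add: field_simps)
    show "\<forall>\<^sub>F x::real in at_top. 1 - 1 / x \<le> real (nat \<lfloor>x\<rfloor>) / x"
      using eventually_gt_at_top[of 0]
    proof eventually_elim
      case (elim x)
      have "x - 1 \<le> real (nat \<lfloor>x\<rfloor>)" by linarith
      then have "(x - 1) / x \<le> real (nat \<lfloor>x\<rfloor>) / x" using elim by (intro divide_right_mono) auto
      then show ?case using elim by (simp add: diff_divide_distrib)
    qed
  qed (real_asymp | simp)+
  show "((\<lambda>X. real (nat \<lfloor>X * y\<rfloor>) / (X * y)) \<longlongrightarrow> 1) at_top"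
    by (rule filterlim_compose[OF * Xy])
qed

text \<open>Substituting x = X y makes the normalized sum the integral of \<open>s X\<close>. Slow
  variation gives the pointwise limit \<open>K * y powr \<gamma> * exp (- y)\<close>, whose integral
  is the Gamma factor, and the Potter bound supplies a majorant.\<close>

lemma Abelian_Laplace_sum:
  fixes v :: "nat \<Rightarrow> real"
  assumes L: "L \<in> borel_measurable (restrict_space borel {0<..})" "slowly_varying L"
    and nonneg: "\<And>n. v n \<ge> 0"
    and lim: "(\<lambda>n. v n / (real n powr \<gamma> * L (real n))) \<longlonglongrightarrow> K"
    and "\<gamma> > 0"
    and summ: "\<And>X. X > 0 \<Longrightarrow> summable (\<lambda>n. v n * exp (- (real n / X)))"
  shows "((\<lambda>X. (\<Sum>n. v n * exp (- (real n / X))) / (X powr (\<gamma> + 1) * L X)) \<longlongrightarrow> K * Gamma (1 + \<gamma>)) at_top"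
proof -
  note Lpos = slowly_varying_pos[OF L(2)]
  \<comment> \<open>This choice keeps both Gamma parameters \<open>\<gamma> + \<epsilon> + 1\<close>
    and \<open>\<gamma> - \<epsilon> + 1\<close> of the majorant positive.\<close>
  define \<epsilon> where "\<epsilon> = \<gamma> / 2"
  have \<epsilon>: "\<epsilon> > 0" "\<gamma> - \<epsilon> > 0" using \<open>\<gamma> > 0\<close> by (auto simp: \<epsilon>_def)
  define s where "s X y = indicator {0..} y * (v (nat \<lfloor>X * y\<rfloor>) * exp (- (real (nat \<lfloor>X * y\<rfloor>) / X)) / (X powr \<gamma> * L X))"
    for X y :: real
  define g where "g a t = indicator {0..} t * t powr (a - 1) / exp t" for a t :: real
  have g: "has_bochner_integral lborel (g a) (Gamma a)" if "a > 0" for a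
    unfolding g_def using has_bochner_integral_Gamma[OF that] .
  have s_eq: "integral\<^sup>L lborel (s X) = (\<Sum>n. v n * exp (- (real n / X))) / (X powr (\<gamma> + 1) * L X)"
    if "X > 0" for X
  proof -
    let ?f = "\<lambda>n. v n * exp (- (real n / X))"
    have "(\<Sum>n. ?f n) = (\<integral>x. indicator {0..} x * ?f (nat \<lfloor>x\<rfloor>) \<partial>(lborel :: real measure))"
      using nonneg summ[OF that] by (intro suminf_eq_integral_floor[symmetric]) auto
    also have "\<dots> = X * (\<integral>y. indicator {0..} (X * y) * ?f (nat \<lfloor>X * y\<rfloor>) \<partial>lborel)"
      using that by (subst lborel_integral_real_affine[where c = X and t = 0]) auto
    also have "(\<integral>y. indicator {0..} (X * y) * ?f (nat \<lfloor>X * y\<rfloor>) \<partial>lborel) = (\<integral>y. (X powr \<gamma> * L X) * s X y \<partial>lborel)"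
      using that Lpos[OF that] by (intro Bochner_Integration.integral_cong) (auto simp: s_def indicator_def zero_le_mult_iff)
    also have "\<dots> = (X powr \<gamma> * L X) * integral\<^sup>L lborel (s X)" by simp
    finally show ?thesis using that Lpos[OF that] by (simp add: powr_add field_simps)
  qed
  obtain X0 where X0: "X0 > 0"
    "\<And>x y. X0 \<le> x \<Longrightarrow> X0 \<le> y \<Longrightarrow> L y \<le> exp (\<epsilon> * (\<bar>ln y - ln x\<bar> + 1)) * L x"
    using slowly_varying_Potter[OF L \<epsilon>(1)] by blast
  have K: "K \<ge> 0"
  proof (rule tendsto_lowerbound[OF lim])
    show "\<forall>\<^sub>F n in sequentially. 0 \<le> v n / (real n powr \<gamma> * L (real n))"
      using eventually_gt_at_top[of 0]
      by eventually_elim (use nonneg Lpos in \<open>auto intro!: divide_nonneg_nonneg mult_nonneg_nonneg simp: less_imp_le\<close>)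
  qed simp
  have "\<forall>\<^sub>F n in sequentially. v n / (real n powr \<gamma> * L (real n)) < K + 1"
    using order_tendstoD(2)[OF lim, of "K + 1"] by simp
  moreover have "\<forall>\<^sub>F n in sequentially. X0 \<le> real n"
    using filterlim_real_sequentially by (simp add: filterlim_at_top)
  ultimately have "\<forall>\<^sub>F n in sequentially. v n \<le> (K + 1) * (real n powr \<gamma> * L (real n)) \<and> X0 \<le> real n \<and> n > 0"
    using eventually_gt_at_top[of 0]
    by eventually_elim (use Lpos in \<open>auto simp: divide_less_eq mult_ac intro!: less_imp_le split: if_splits\<close>)
  then obtain N where N: "\<And>n. n \<ge> N \<Longrightarrow> v n \<le> (K + 1) * (real n powr \<gamma> * L (real n)) \<and> X0 \<le> real n \<and> n > 0"
    by (auto simp: eventually_sequentially)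
  \<comment> \<open>Below \<open>N\<close> the asymptotics say nothing; these finitely many terms
    are bounded by their sum.\<close>
  define B where "B = (\<Sum>n<N. v n)"
  have B: "v n \<le> B" if "n < N" for n
    unfolding B_def using that nonneg by (intro member_le_sum) auto
  have B0: "B \<ge> 0" unfolding B_def using nonneg by (intro sum_nonneg) auto
  \<comment> \<open>The first summand covers indices below \<open>N\<close>, once
    \<open>X powr \<gamma> * L X\<close> exceeds 1; the second covers the Potter range. The factor
    \<open>exp 1\<close> and the \<open>+ 1\<close> come from rounding down, since n/X \<ge> y - 1
    for X \<ge> 1; \<open>2 * \<epsilon>\<close> is the slack in the logarithms.\<close>
  define w where "w y = exp 1 * B * g 1 y + (K + 1) * exp (2 * \<epsilon> + 1) * (g (\<gamma> + \<epsilon> + 1) y + g (\<gamma> - \<epsilon> + 1) y)" for y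
  have "((\<lambda>X. integral\<^sup>L lborel (s X)) \<longlongrightarrow> integral\<^sup>L lborel (\<lambda>y. K * g (1 + \<gamma>) y)) at_top"
  proof (rule integral_dominated_convergence_at_top[where s = s and w = w])
    show "(\<lambda>y. K * g (1 + \<gamma>) y) \<in> borel_measurable lborel"
      unfolding g_def by measurable
    show "s X \<in> borel_measurable lborel" for X
      unfolding s_def by measurable
    show "integrable lborel w"
      unfolding w_def using g[of 1] g[of "\<gamma> + \<epsilon> + 1"] g[of "\<gamma> - \<epsilon> + 1"] \<epsilon> \<open>\<gamma> > 0\<close>
      by (intro Bochner_Integration.integrable_add integrable_mult_right)
         (auto simp: has_bochner_integral_iff)
    \<comment> \<open>The point y = 0 is discarded because the index stays 0 there; for y > 0 it
      tends to infinity.\<close>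
    show "AE y in lborel. ((\<lambda>X. s X y) \<longlongrightarrow> K * g (1 + \<gamma>) y) at_top"
      using AE_lborel_singleton[of "0::real"]
    proof eventually_elim
      case (elim y)
      consider "y < 0" | "y > 0" using elim by linarith
      then show ?case
      proof cases
        case 1
        then show ?thesis by (simp add: s_def g_def)
      next
        case 2
        define n where "n X = nat \<lfloor>X * y\<rfloor>" for X
        note n_lim = filterlim_nat_floor_mult[OF 2, folded n_def]
        have Xy: "filterlim (\<lambda>X. X * y) at_top at_top"
          using 2 by (intro filterlim_at_top_mult_tendsto_pos[OF tendsto_const _ filterlim_ident])
        have nX: "((\<lambda>X. real (n X) / X) \<longlongrightarrow> y) at_top"
          using tendsto_mult_right[OF n_lim(2), of y] 2 by (simp add: field_simps)
        have 1: "((\<lambda>X. v (n X) / (real (n X) powr \<gamma> * L (real (n X)))) \<longlongrightarrow> K) at_top"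
          by (rule filterlim_compose[OF lim n_lim(1)])
        have 3: "((\<lambda>X. L (real (n X)) / L (X * y)) \<longlongrightarrow> 1) at_top"
          by (rule slowly_varying_asymp_arg[OF L Xy n_lim(2)])
        have 4: "((\<lambda>X. L (X * y) / L X) \<longlongrightarrow> 1) at_top"
          using L(2) 2 by (auto simp: slowly_varying_def mult.commute)
        \<comment> \<open>The product telescopes to \<open>s X y\<close>, and each of its factors
          has a known limit.\<close>
        have "((\<lambda>X. v (n X) / (real (n X) powr \<gamma> * L (real (n X))) * (real (n X) / X) powr \<gamma>
            * (L (real (n X)) / L (X * y)) * (L (X * y) / L X) * exp (- (real (n X) / X))) \<longlongrightarrow> K * y powr \<gamma> * 1 * 1 * exp (- y)) at_top"
          using 2 by (intro tendsto_intros 1 3 4 nX) auto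
        moreover have "\<forall>\<^sub>F X in at_top. v (n X) / (real (n X) powr \<gamma> * L (real (n X))) * (real (n X) / X) powr \<gamma>
            * (L (real (n X)) / L (X * y)) * (L (X * y) / L X) * exp (- (real (n X) / X)) = s X y"
          using eventually_gt_at_top[of 0] eventually_compose_filterlim[OF eventually_gt_at_top[of 0] n_lim(1)]
        proof eventually_elim
          case (elim X)
          have "L (real (n X)) > 0" "L (X * y) > 0" "L X > 0"
            using elim 2 Lpos by auto
          then show ?case using elim 2 by (simp add: s_def n_def[symmetric] powr_divide field_simps)
        qed
        ultimately have "((\<lambda>X. s X y) \<longlongrightarrow> K * y powr \<gamma> * 1 * 1 * exp (- y)) at_top"
          by (rule Lim_transform_eventually)
        then show ?thesis using 2 by (simp add: g_def exp_minus field_simps)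
      qed
    qed
    show "\<forall>\<^sub>F X in at_top. AE y in lborel. norm (s X y) \<le> w y"
      using eventually_ge_at_top[of 1] eventually_ge_at_top[of X0]
        filterlim_at_top[THEN iffD1, OF slowly_varying_powr_at_top[OF L \<open>\<gamma> > 0\<close>], rule_format, of 1]
    proof eventually_elim
      case (elim X)
      have X: "X \<ge> 1" "X > 0" "X0 \<le> X" "X powr \<gamma> * L X \<ge> 1" using elim by auto
      show "AE y in lborel. norm (s X y) \<le> w y"
        using AE_lborel_singleton[of "0::real"]
      proof eventually_elim
        case (elim y)
        consider "y < 0" | "y > 0" using elim by linarith
        then show ?case
        proof cases
          case 1
          then show ?thesis by (simp add: s_def w_def g_def)
        next
          case 2
          define n where "n = nat \<lfloor>X * y\<rfloor>"
          have s_n: "norm (s X y) = v n / (X powr \<gamma> * L X) * exp (- (real n / X))"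
            using 2 X nonneg by (simp add: s_def n_def[symmetric])
          have gs: "g a y = y powr (a - 1) * exp (- y)" for a
            using 2 by (simp add: g_def exp_minus field_simps)
          have gn: "g a y \<ge> 0" for a by (simp add: gs)
          have n_ge: "X * y - 1 \<le> real n" and n_le: "real n \<le> X * y"
            using 2 X by (auto simp: n_def)
          have "y - 1 \<le> y - 1 / X" using X by simp
          also have "\<dots> = (X * y - 1) / X" using X by (simp add: field_simps)
          also have "\<dots> \<le> real n / X" using n_ge X by (intro divide_right_mono) auto
          finally have "exp (- (real n / X)) \<le> exp (1 - y)" by simp
          then have en: "exp (- (real n / X)) \<le> exp 1 * exp (- y)" by (simp add: exp_diff exp_minus field_simps)
          show ?thesis
          proof (cases "n < N")
            case True
            have "v n / (X powr \<gamma> * L X) \<le> B / 1"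
              using B[OF True] X(4) B0 by (intro frac_le) auto
            then have "norm (s X y) \<le> B * (exp 1 * exp (- y))"
              unfolding s_n using en B0 by (intro mult_mono) auto
            also have "\<dots> = exp 1 * B * g 1 y" using 2 by (simp add: gs)
            also have "\<dots> \<le> w y" unfolding w_def using gn K by (simp add: add_nonneg_nonneg)
            finally show ?thesis .
          next
            case False
            then have n: "v n \<le> (K + 1) * (real n powr \<gamma> * L (real n))" "X0 \<le> real n" "n > 0"
              using N[of n] by auto
            have "ln (real n) \<le> ln (X * y)" using n_le n(3) by (intro ln_mono) auto
            then have l1: "ln (real n) \<le> ln X + ln y" using X 2 by (simp add: ln_mult)
            \<comment> \<open>Since n \<ge> 1, X y \<le> n + 1 \<le> 2 n; then ln 2 < 1 gives the
              two-sided logarithmic bound.\<close>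
            have "ln (X * y) \<le> ln (2 * real n)" using n_ge n(3) X 2 by (subst ln_le_cancel_iff) auto
            then have l2: "ln X + ln y \<le> ln (real n) + 1"
              using X 2 n(3) ln_2_less_1 by (simp add: ln_mult)
            have "\<bar>ln (real n) - ln X\<bar> \<le> \<bar>ln y\<bar> + 1" using l1 l2 by linarith
            then have "exp (\<epsilon> * (\<bar>ln (real n) - ln X\<bar> + 1)) \<le> exp (\<epsilon> * (\<bar>ln y\<bar> + 2))"
              using \<epsilon>(1) by simp
            also have "\<dots> = exp (\<epsilon> * \<bar>ln y\<bar>) * exp (2 * \<epsilon>)"
              by (simp add: exp_add[symmetric] algebra_simps)
            also have "\<dots> \<le> (y powr \<epsilon> + y powr (- \<epsilon>)) * exp (2 * \<epsilon>)"
              using exp_abs_ln_le[OF 2] by (intro mult_right_mono) auto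
            finally have e: "exp (\<epsilon> * (\<bar>ln (real n) - ln X\<bar> + 1)) \<le> (y powr \<epsilon> + y powr (- \<epsilon>)) * exp (2 * \<epsilon>)" .
            have "L (real n) \<le> exp (\<epsilon> * (\<bar>ln (real n) - ln X\<bar> + 1)) * L X"
              using X0(2) X(3) n(2) by auto
            also have "\<dots> \<le> (y powr \<epsilon> + y powr (- \<epsilon>)) * exp (2 * \<epsilon>) * L X"
              using e Lpos[OF X(2)] by (intro mult_right_mono) auto
            finally have Ln: "L (real n) \<le> (y powr \<epsilon> + y powr (- \<epsilon>)) * exp (2 * \<epsilon>) * L X" .
            have pn: "real n powr \<gamma> \<le> X powr \<gamma> * y powr \<gamma>"
              using n_le X 2 \<open>\<gamma> > 0\<close> by (subst powr_mult[symmetric]) (auto intro: powr_mono2)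
            have "v n \<le> (K + 1) * ((X powr \<gamma> * y powr \<gamma>) * ((y powr \<epsilon> + y powr (- \<epsilon>)) * exp (2 * \<epsilon>) * L X))"
              using n(1) mult_left_mono[OF mult_mono[OF pn Ln], of "K + 1"] K Lpos[of "real n"] n(3) by (auto intro: order_trans)
            then have "v n / (X powr \<gamma> * L X) \<le> (K + 1) * (y powr \<gamma> * ((y powr \<epsilon> + y powr (- \<epsilon>)) * exp (2 * \<epsilon>)))"
              using X Lpos[OF X(2)] by (simp add: divide_le_eq mult_ac)
            then have "norm (s X y) \<le> (K + 1) * (y powr \<gamma> * ((y powr \<epsilon> + y powr (- \<epsilon>)) * exp (2 * \<epsilon>))) * (exp 1 * exp (- y))"
              unfolding s_n using en K nonneg by (intro mult_mono) auto
            also have "\<dots> = (K + 1) * exp (2 * \<epsilon> + 1) * (g (\<gamma> + \<epsilon> + 1) y + g (\<gamma> - \<epsilon> + 1) y)"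
            proof -
              have "y powr (\<gamma> + \<epsilon> + 1 - 1) = y powr \<gamma> * y powr \<epsilon>"
                "y powr (\<gamma> - \<epsilon> + 1 - 1) = y powr \<gamma> * y powr (- \<epsilon>)"
                by (simp_all add: powr_add[symmetric])
              then show ?thesis unfolding gs exp_add by (simp only: algebra_simps)
            qed
            also have "\<dots> \<le> w y" unfolding w_def using gn B0 by simp
            finally show ?thesis .
          qed
        qed
      qed
    qed
  qed
  also have "integral\<^sup>L lborel (\<lambda>y. K * g (1 + \<gamma>) y) = K * Gamma (1 + \<gamma>)"
    using g[of "1 + \<gamma>"] \<open>\<gamma> > 0\<close> by (simp add: has_bochner_integral_iff)
  finally show ?thesis
    by (rule Lim_transform_eventually[OF _ eventually_mono[OF eventually_gt_at_top[of 0] s_eq]])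
qed

section \<open>Weak convergence on the unit interval\<close>

text \<open>The remainder of the finite geometric sum with ratio -au has modulus (au)^(k+1) / (1 +
  au).\<close>

lemma geometric_resolvent_bound:
  fixes a u :: real
  assumes "0 \<le> a" "u \<in> {0..1}"
  shows "\<bar>1 / (1 + a * u) - (\<Sum>j\<le>k. (- a) ^ j * u ^ j)\<bar> \<le> a ^ Suc k"
proof -
  have au: "0 \<le> a * u" "a * u \<le> a" using assms by (auto simp: mult_left_le)
  have "(\<Sum>j\<le>k. (- a) ^ j * u ^ j) = (\<Sum>j<Suc k. (- (a * u)) ^ j)"
    by (simp add: lessThan_Suc_atMost power_mult_distrib[symmetric])
  also have "\<dots> = (1 - (- (a * u)) ^ Suc k) / (1 + a * u)"
    using au by (subst sum_gp_strict) auto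
  finally have "1 / (1 + a * u) - (\<Sum>j\<le>k. (- a) ^ j * u ^ j) = (- (a * u)) ^ Suc k / (1 + a * u)"
    by (simp only: diff_divide_distrib)
  also have "\<bar>\<dots>\<bar> = (a * u) ^ Suc k / (1 + a * u)"
    using au assms by (simp add: abs_mult power_abs)
  also have "\<dots> \<le> (a * u) ^ Suc k / 1"
    using au by (intro frac_le) auto
  also have "\<dots> \<le> a ^ Suc k" using au power_mono[of "a * u" a "Suc k"] by simp
  finally show ?thesis .
qed

text \<open>The laws stay distributions on the whole line, concentrated on the unit interval, so
  that weak convergence of real distributions applies to them directly.\<close>

definition unit_distribution :: "real measure \<Rightarrow> bool" where
  "unit_distribution N \<longleftrightarrow> real_distribution N \<and> (AE u in N. u \<in> {0..1})"

lemma unit_distribution_integrable: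
  fixes f :: "real \<Rightarrow> real"
  assumes N: "unit_distribution N" and f: "f \<in> borel_measurable borel"
    and B: "\<And>u. u \<in> {0..1} \<Longrightarrow> \<bar>f u\<bar> \<le> B"
  shows "integrable N f"
proof -
  interpret real_distribution N using N by (simp add: unit_distribution_def)
  have ae: "AE u in N. u \<in> {0..1}" using N by (simp add: unit_distribution_def)
  show ?thesis
  proof (rule integrable_const_bound[of _ B])
    show "AE u in N. norm (f u) \<le> B" using ae by eventually_elim (use B in auto)
    show "f \<in> borel_measurable N" using f by simp
  qed
qed

lemma unit_distribution_integral_bound:
  fixes f :: "real \<Rightarrow> real"
  assumes N: "unit_distribution N" and f: "f \<in> borel_measurable borel"
    and B: "\<And>u. u \<in> {0..1} \<Longrightarrow> \<bar>f u\<bar> \<le> B"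
  shows "\<bar>integral\<^sup>L N f\<bar> \<le> B"
proof -
  interpret real_distribution N using N by (simp add: unit_distribution_def)
  have ae: "AE u in N. u \<in> {0..1}" using N by (simp add: unit_distribution_def)
  have int: "integrable N f" by (rule unit_distribution_integrable[OF assms])
  have "\<bar>integral\<^sup>L N f\<bar> \<le> integral\<^sup>L N (\<lambda>u. \<bar>f u\<bar>)"
    using integral_norm_bound[of N f] by simp
  also have "\<dots> \<le> integral\<^sup>L N (\<lambda>u. B)"
  proof (rule integral_mono_AE)
    show "AE u in N. \<bar>f u\<bar> \<le> B" using ae by eventually_elim (use B in auto)
  qed (use int in auto)
  also have "\<dots> = B" using prob_space by simp
  finally show ?thesis .
qed

lemma unit_distribution_integrable_power [simp]:
  assumes "unit_distribution N"
  shows "integrable N (\<lambda>u::real. u ^ j)"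
  by (rule unit_distribution_integrable[OF assms, where B = 1]) (auto simp: power_abs power_le_one)

lemma unit_distribution_integrable_resolvent:
  assumes "unit_distribution N" "0 \<le> a"
  shows "integrable N (\<lambda>u::real. 1 / (1 + a * u))"
  using assms by (intro unit_distribution_integrable[where B = 1]) (auto simp: divide_le_eq add_nonneg_pos)

lemma moment_expansion_bound:
  assumes N: "unit_distribution N" and a: "0 \<le> a"
  shows "\<bar>(\<integral>u. 1 / (1 + a * u) \<partial>N) - (\<Sum>j\<le>k. (- a) ^ j * (\<integral>u. u ^ j \<partial>N))\<bar> \<le> a ^ Suc k"
proof -
  have "(\<integral>u. 1 / (1 + a * u) - (\<Sum>j\<le>k. (- a) ^ j * u ^ j) \<partial>N)
      = (\<integral>u. 1 / (1 + a * u) \<partial>N) - (\<Sum>j\<le>k. (- a) ^ j * (\<integral>u. u ^ j \<partial>N))"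
    using N a by (subst Bochner_Integration.integral_diff)
      (auto intro!: unit_distribution_integrable_resolvent)
  moreover have "\<bar>(\<integral>u. 1 / (1 + a * u) - (\<Sum>j\<le>k. (- a) ^ j * u ^ j) \<partial>N)\<bar> \<le> a ^ Suc k"
    by (rule unit_distribution_integral_bound[OF N]) (use geometric_resolvent_bound[OF a] in auto)
  ultimately show ?thesis by simp
qed

lemma moments_sums_resolvent:
  assumes N: "unit_distribution N" and a: "0 \<le> a" "a < 1"
  shows "(\<lambda>j. (- a) ^ j * (\<integral>u. u ^ j \<partial>N)) sums (\<integral>u. 1 / (1 + a * u) \<partial>N)"
  unfolding sums_def_le
proof (rule LIM_zero_cancel, rule Lim_null_comparison)
  show "\<forall>\<^sub>F k in sequentially. norm ((\<Sum>j\<le>k. (- a) ^ j * (\<integral>u. u ^ j \<partial>N)) - (\<integral>u. 1 / (1 + a * u) \<partial>N)) \<le> a ^ Suc k"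
    using moment_expansion_bound[OF N a(1)] by (auto simp: abs_minus_commute)
  show "(\<lambda>k. a ^ Suc k) \<longlonglongrightarrow> 0"
    using a by (intro LIMSEQ_Suc LIMSEQ_realpow_zero)
qed

text \<open>Induction on \<open>k\<close>. Expanding the resolvent in powers of \<open>a\<close>
  isolates the k-th moment at order a^k, with known lower moments and an error of order a^(k+1).
  Dividing by a^k leaves an error 2a that is uniform in \<open>n\<close>, so \<open>a\<close> is
  fixed first and \<open>n\<close> is sent to infinity afterwards.\<close>

lemma moments_converge_of_resolvents:
  assumes N: "\<And>n. unit_distribution (N n)" and M: "unit_distribution M"
    and lim: "\<And>a. 0 < a \<Longrightarrow> a < 1 \<Longrightarrow> (\<lambda>n. \<integral>u. 1 / (1 + a * u) \<partial>N n) \<longlonglongrightarrow> (\<integral>u. 1 / (1 + a * u) \<partial>M)"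
  shows "(\<lambda>n. \<integral>u. u ^ k \<partial>N n) \<longlonglongrightarrow> (\<integral>u. u ^ k \<partial>M)"
proof (induction k rule: less_induct)
  case (less k)
  define d where "d j n = (\<integral>u. u ^ j \<partial>N n) - (\<integral>u. u ^ j \<partial>M)" for j n
  define I where "I a n = (\<integral>u. 1 / (1 + a * u) \<partial>N n) - (\<integral>u. 1 / (1 + a * u) \<partial>M)" for a n
  have d0: "(\<lambda>n. d j n) \<longlonglongrightarrow> 0" if "j < k" for j
    unfolding d_def using less.IH[OF that] by (rule LIM_zero)
  have I0: "(\<lambda>n. I a n) \<longlonglongrightarrow> 0" if "0 < a" "a < 1" for a
    unfolding I_def using lim[OF that] by (rule LIM_zero)
  have bound: "a ^ k * \<bar>d k n\<bar> \<le> \<bar>I a n\<bar> + (\<Sum>j<k. \<bar>(- a) ^ j * d j n\<bar>) + 2 * a ^ Suc k" if a: "0 < a" for a n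
  proof -
    let ?S = "\<lambda>Q. (\<Sum>j\<le>k. (- a) ^ j * (\<integral>u. u ^ j \<partial>Q))"
    have eq: "?S (N n) - ?S M = (\<Sum>j<k. (- a) ^ j * d j n) + (- a) ^ k * d k n"
      by (simp add: d_def right_diff_distrib sum_subtractf lessThan_Suc_atMost[symmetric])
    have "\<bar>?S (N n) - ?S M - I a n\<bar> \<le> 2 * a ^ Suc k"
      using moment_expansion_bound[OF N[of n], of a k] moment_expansion_bound[OF M, of a k] a
      unfolding I_def by linarith
    moreover have "\<bar>\<Sum>j<k. (- a) ^ j * d j n\<bar> \<le> (\<Sum>j<k. \<bar>(- a) ^ j * d j n\<bar>)" by (rule sum_abs)
    ultimately have "\<bar>(- a) ^ k * d k n\<bar> \<le> \<bar>I a n\<bar> + (\<Sum>j<k. \<bar>(- a) ^ j * d j n\<bar>) + 2 * a ^ Suc k"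
      unfolding eq by linarith
    then show ?thesis using a by (simp add: abs_mult power_abs)
  qed
  have "(\<lambda>n. d k n) \<longlonglongrightarrow> 0"
  proof (rule tendstoI)
    fix e :: real assume e: "e > 0"
    \<comment> \<open>The truncation error 2a is then at most e/4, which joins the e/2 granted to
      the remaining terms; the 1/2 keeps a < 1.\<close>
    define a where "a = min (1/2) (e/8)"
    have a: "0 < a" "a < 1" "2 * a \<le> e / 4" using e by (auto simp: a_def)
    have "(\<lambda>n. \<bar>I a n\<bar> + (\<Sum>j<k. \<bar>(- a) ^ j * d j n\<bar>)) \<longlonglongrightarrow> \<bar>0\<bar> + (\<Sum>j<k. \<bar>(- a) ^ j * 0\<bar>)"
      using a by (intro tendsto_intros I0 d0) auto
    then have "\<forall>\<^sub>F n in sequentially. \<bar>I a n\<bar> + (\<Sum>j<k. \<bar>(- a) ^ j * d j n\<bar>) < a ^ k * (e / 2)"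
      using a e by (intro order_tendstoD(2)) auto
    then show "\<forall>\<^sub>F n in sequentially. dist (d k n) 0 < e"
    proof eventually_elim
      case (elim n)
      have "a ^ k * \<bar>d k n\<bar> < a ^ k * (e / 2) + 2 * a ^ Suc k"
        using bound[OF a(1), of n] elim by linarith
      also have "\<dots> = a ^ k * (e / 2 + 2 * a)" by (simp add: algebra_simps)
      finally have "\<bar>d k n\<bar> < e / 2 + 2 * a" using a by simp
      then show ?case using a e by simp
    qed
  qed
  then show ?case unfolding d_def by (rule LIM_zero_cancel)
qed

text \<open>It suffices to test continuous steps. By Stone-Weierstrass these are uniformly close to
  polynomials on the unit interval, whose integrals are combinations of moments.\<close>

lemma weak_conv_of_resolvents:
  assumes N: "\<And>n. unit_distribution (N n)" and M: "unit_distribution M"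
    and lim: "\<And>a. 0 < a \<Longrightarrow> a < 1 \<Longrightarrow> (\<lambda>n. \<integral>u. 1 / (1 + a * u) \<partial>N n) \<longlonglongrightarrow> (\<integral>u. 1 / (1 + a * u) \<partial>M)"
  shows "weak_conv_m N M"
proof (rule integral_cts_step_conv_imp_weak_conv)
  show "real_distribution (N n)" for n using N by (simp add: unit_distribution_def)
  show "real_distribution M" using M by (simp add: unit_distribution_def)
  fix x y :: real assume xy: "x < y"
  have cont: "continuous_on {0..1} (cts_step x y)"
    using uniformly_continuous_imp_continuous[OF cts_step_uniformly_continuous[OF xy]]
    by (rule continuous_on_subset) simp
  have meas: "cts_step x y \<in> borel_measurable borel"
    unfolding cts_step_def by measurable
  have intc: "integrable Q (cts_step x y)" if "unit_distribution Q" for Q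
    using that xy by (intro real_distribution.integrable_cts_step) (auto simp: unit_distribution_def)
  show "(\<lambda>n. integral\<^sup>L (N n) (cts_step x y)) \<longlonglongrightarrow> integral\<^sup>L M (cts_step x y)"
  proof (rule tendstoI)
    fix e :: real assume e: "e > 0"
    obtain p where p: "real_polynomial_function p" "\<And>u. u \<in> {0..1} \<Longrightarrow> \<bar>cts_step x y u - p u\<bar> < e / 3"
      using Stone_Weierstrass_real_polynomial_function[OF _ cont, of "e / 3"] e by auto
    obtain c m where pc: "p = (\<lambda>u. \<Sum>i\<le>m. c i * u ^ i)"
      using p(1) real_polynomial_function_iff_sum by blast
    have pm: "p \<in> borel_measurable borel" unfolding pc by measurable
    have intp: "integrable Q p" if "unit_distribution Q" for Q
      unfolding pc using that by auto
    have near: "\<bar>integral\<^sup>L Q (cts_step x y) - integral\<^sup>L Q p\<bar> \<le> e / 3" if Q: "unit_distribution Q" for Q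
    proof -
      have "\<bar>integral\<^sup>L Q (\<lambda>u. cts_step x y u - p u)\<bar> \<le> e / 3"
        using p(2) meas pm by (intro unit_distribution_integral_bound[OF Q]) (auto intro: less_imp_le)
      then show ?thesis using intc[OF Q] intp[OF Q] by simp
    qed
    have "(\<lambda>n. \<Sum>i\<le>m. c i * (\<integral>u. u ^ i \<partial>N n)) \<longlonglongrightarrow> (\<Sum>i\<le>m. c i * (\<integral>u. u ^ i \<partial>M))"
      by (intro tendsto_intros moments_converge_of_resolvents assms)
    moreover have "integral\<^sup>L Q p = (\<Sum>i\<le>m. c i * (\<integral>u. u ^ i \<partial>Q))" if "unit_distribution Q" for Q
      unfolding pc using that by simp
    ultimately have "(\<lambda>n. integral\<^sup>L (N n) p) \<longlonglongrightarrow> integral\<^sup>L M p"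
      using N M by simp
    then have "\<forall>\<^sub>F n in sequentially. dist (integral\<^sup>L (N n) p) (integral\<^sup>L M p) < e / 3"
      using e by (intro tendstoD) auto
    then show "\<forall>\<^sub>F n in sequentially. dist (integral\<^sup>L (N n) (cts_step x y)) (integral\<^sup>L M (cts_step x y)) < e"
    proof eventually_elim
      case (elim n)
      then show ?case using near[OF N[of n]] near[OF M] unfolding dist_real_def by linarith
    qed
  qed
qed

section \<open>The Stieltjes transform and the Beta distribution\<close>

lemma Beta_complement_real:
  fixes b :: real
  assumes "0 < b" "b < 1"
  shows "Beta b (1 - b) = pi / sin (pi * b)"
proof -
  have "complex_of_real (Gamma b * Gamma (1 - b)) = of_real (pi / sin (pi * b))"
    using Gamma_reflection_complex[of "of_real b"]
    by (simp add: Gamma_complex_of_real[symmetric] sin_of_real[symmetric])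
  then have "Gamma b * Gamma (1 - b) = pi / sin (pi * b)" by (simp only: of_real_eq_iff)
  then show ?thesis by (simp add: Beta_def)
qed

lemma has_bochner_integral_Beta:
  assumes "a > 0" "b > (0::real)"
  shows "has_bochner_integral lborel (\<lambda>t. indicator {0..1} t * (t powr (a - 1) * (1 - t) powr (b - 1))) (Beta a b)"
  using integrable_Beta[OF assms] set_borel_integral_eq_integral(2)[OF integrable_Beta[OF assms]]
    integral_unique[OF has_integral_Beta_real[OF assms]]
  by (simp add: has_bochner_integral_iff set_integrable_def set_lebesgue_integral_def)

section \<open>Beta laws with the complementary parameters \<open>b\<close> and
  \<open>1 - b\<close>\<close>

definition beta_density :: "real \<Rightarrow> real \<Rightarrow> real" where
  "beta_density b u = indicator {0..1} u * (u powr (b - 1) * (1 - u) powr (- b)) / Beta b (1 - b)"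

definition beta_dist :: "real \<Rightarrow> real measure" where
  "beta_dist b = density lborel (\<lambda>u. ennreal (beta_density b u))"

lemma beta_density_measurable [measurable]: "beta_density b \<in> borel_measurable borel"
  unfolding beta_density_def by measurable

context
  fixes b :: real
  assumes b: "0 < b" "b < 1"
begin

lemma Beta_complement_pos: "Beta b (1 - b) > 0"
  using b by (simp add: Beta_def)

lemma beta_density_nonneg: "beta_density b u \<ge> 0"
  using Beta_complement_pos by (simp add: beta_density_def)

lemma beta_dist_integral:
  fixes f :: "real \<Rightarrow> real"
  assumes "f \<in> borel_measurable borel"
  shows "integral\<^sup>L (beta_dist b) f = (\<integral>u. beta_density b u * f u \<partial>lborel)"
  unfolding beta_dist_def using assms beta_density_nonneg
  by (subst integral_density) auto

lemma beta_dist_moment: "(\<integral>u. u ^ k \<partial>beta_dist b) = Beta (b + real k) (1 - b) / Beta b (1 - b)"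
proof -
  have "(\<integral>u. u ^ k \<partial>beta_dist b) = (\<integral>u. beta_density b u * u ^ k \<partial>lborel)"
    by (rule beta_dist_integral) measurable
  also have "\<dots> = (\<integral>u. indicator {0..1} u * (u powr (b + real k - 1) * (1 - u) powr (1 - b - 1)) / Beta b (1 - b) \<partial>lborel)"
  proof (rule Bochner_Integration.integral_cong)
    fix u :: real
    show "beta_density b u * u ^ k = indicator {0..1} u * (u powr (b + real k - 1) * (1 - u) powr (1 - b - 1)) / Beta b (1 - b)"
    proof (cases "u > 0")
      case True
      then have "u powr (b + real k - 1) = u powr (b - 1) * u ^ k"
        by (simp add: powr_realpow[symmetric] powr_add[symmetric] algebra_simps)
      then show ?thesis by (simp add: beta_density_def)
    qed (auto simp: beta_density_def indicator_def)
  qed simp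
  also have "\<dots> = Beta (b + real k) (1 - b) / Beta b (1 - b)"
    using has_bochner_integral_Beta[of "b + real k" "1 - b"] b by (simp add: has_bochner_integral_iff)
  finally show ?thesis .
qed

lemma unit_distribution_beta_dist: "unit_distribution (beta_dist b)"
proof -
  have "has_bochner_integral lborel (beta_density b) 1"
    using has_bochner_integral_divide_zero[OF has_bochner_integral_Beta[of b "1 - b"], of "Beta b (1 - b)"] b Beta_complement_pos
    by (simp add: beta_density_def[abs_def])
  then have "(\<integral>\<^sup>+u. ennreal (beta_density b u) \<partial>lborel) = 1"
    using nn_integral_eq_integral[of lborel "beta_density b"] beta_density_nonneg
    by (simp add: has_bochner_integral_iff)
  then have "emeasure (beta_dist b) (space (beta_dist b)) = 1"
    by (simp add: beta_dist_def emeasure_density)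
  then have "prob_space (beta_dist b)" by (rule prob_spaceI)
  then have "real_distribution (beta_dist b)"
    by (simp add: real_distribution_def real_distribution_axioms_def beta_dist_def)
  moreover have "AE u in beta_dist b. u \<in> {0..1}"
    unfolding beta_dist_def by (subst AE_density) (auto simp: beta_density_def indicator_def)
  ultimately show ?thesis by (simp add: unit_distribution_def)
qed

text \<open>Because the parameters add up to 1, the j-th moment is
  \<open>pochhammer b j / fact j\<close>. The alternating moment series is therefore the binomial
  series of \<open>(1 + a) powr (- b)\<close>.\<close>

lemma beta_dist_resolvent:
  assumes a: "0 \<le> a" "a < 1"
  shows "(\<integral>u. 1 / (1 + a * u) \<partial>beta_dist b) = (1 + a) powr (- b)"
proof -
  have "(- a) ^ j * (\<integral>u. u ^ j \<partial>beta_dist b) = ((- b) gchoose j) * a ^ j" for j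
  proof -
    have "b \<notin> \<int>\<^sub>\<le>\<^sub>0" using b by (auto elim!: nonpos_Ints_cases)
    then have "Gamma (b + real j) / Gamma b = pochhammer b j" by (simp add: pochhammer_Gamma)
    moreover have "Gamma (1 - b) \<noteq> 0" "Gamma b \<noteq> 0" using b by (auto simp: less_imp_neq[symmetric])
    moreover have "Gamma (b + real j + (1 - b)) = fact j" using Gamma_fact[of j, where 'a = real] by (simp add: add.commute)
    ultimately have "Beta (b + real j) (1 - b) / Beta b (1 - b) = pochhammer b j / fact j"
      by (simp add: Beta_def divide_simps)
    then show ?thesis
      by (simp add: beta_dist_moment gbinomial_pochhammer power_minus[of a])
  qed
  then have "(\<lambda>j. ((- b) gchoose j) * a ^ j) sums (\<integral>u. 1 / (1 + a * u) \<partial>beta_dist b)"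
    using moments_sums_resolvent[OF unit_distribution_beta_dist a] by simp
  moreover have "(\<lambda>j. ((- b) gchoose j) * a ^ j) sums (1 + a) powr (- b)"
    using a by (intro gen_binomial_real) auto
  ultimately show ?thesis by (rule sums_unique2)
qed

text \<open>Absolute continuity admits test functions with a single discontinuity. The form with a
  subset fits discontinuity sets that are only known to lie in a singleton.\<close>

lemma beta_dist_subsingleton_null:
  assumes "D \<subseteq> {c}"
  shows "emeasure (beta_dist b) D = 0"
proof -
  have "null_sets lborel \<subseteq> null_sets (beta_dist b)"
    using absolutely_continuousI_density[of "\<lambda>u. ennreal (beta_density b u)" lborel]
    by (simp add: beta_dist_def absolutely_continuous_def)
  moreover have "{c} \<in> null_sets lborel"
    by (simp add: null_sets_def)
  ultimately have "{c} \<in> null_sets (beta_dist b)" by blast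
  then have "emeasure (beta_dist b) D \<le> 0"
    using assms by (metis emeasure_mono null_setsD1 null_setsD2)
  then show ?thesis by simp
qed

text \<open>The substitution \<open>u = 1 / (1 + s)\<close> turns this into \<open>\<integral>\<^sub>0\<^sup>1 s powr (- b) ds\<close>.\<close>

lemma beta_dist_integral_upper_half:
  "(\<integral>u. (if 1/2 \<le> u then 1 / u else 0) \<partial>beta_dist b) = sin (pi * b) / (pi * (1 - b))"
proof -
  let ?f = "\<lambda>u::real. u powr (b - 2) * (1 - u) powr (- b)"
  \<comment> \<open>The antiderivative is -s^(1-b)/(1-b) with s = (1-u)/u. It is continuous up to u
    = 1, where the integrand is unbounded, so the derivative is taken only in the interior.\<close>
  have "(?f has_integral (- (((1 - 1) / 1) powr (1 - b) / (1 - b)) - - (((1 - 1/2) / (1/2)) powr (1 - b) / (1 - b)))) {1/2..1}"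
  proof (rule fundamental_theorem_of_calculus_interior)
    show "continuous_on {1/2..1::real} (\<lambda>u. - (((1 - u) / u) powr (1 - b) / (1 - b)))"
      using b by (intro continuous_intros continuous_on_powr') auto
    fix u :: real assume u: "u \<in> {1/2<..<1}"
    have q: "((\<lambda>u. (1 - u) / u) has_real_derivative - 1 / (u * u)) (at u)"
      using u by (auto intro!: derivative_eq_intros simp: field_simps power2_eq_square)
    have "((\<lambda>u. - (((1 - u) / u) powr (1 - b) / (1 - b))) has_real_derivative
        - ((1 - b) * ((1 - u) / u) powr (1 - b - of_nat 1) * (- 1 / (u * u)) / (1 - b))) (at u)"
      using u by (intro DERIV_minus DERIV_cdivide DERIV_fun_powr[OF q]) auto
    also have "- ((1 - b) * ((1 - u) / u) powr (1 - b - of_nat 1) * (- 1 / (u * u)) / (1 - b))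
        = ((1 - u) / u) powr (- b) / u powr 2"
      using u b by (simp add: power2_eq_square)
    also have "\<dots> = ?f u"
      using u by (simp add: powr_divide powr_diff powr_minus field_simps)
    finally show "((\<lambda>u. - (((1 - u) / u) powr (1 - b) / (1 - b))) has_vector_derivative ?f u) (at u)"
      by (simp add: has_real_derivative_iff_has_vector_derivative)
  qed simp
  then have hi: "(?f has_integral (1 / (1 - b))) {1/2..1}"
    using b by simp
  have "(\<integral>\<^sup>+u. ennreal (indicator {1/2..1} u * ?f u) \<partial>lborel) = ennreal (1 / (1 - b))"
    using nn_integral_has_integral_lebesgue[OF _ hi] by (simp add: nn_integral_completion)
  then have hb: "has_bochner_integral lborel (\<lambda>u. indicator {1/2..1} u * ?f u) (1 / (1 - b))"
    using b by (intro has_bochner_integral_nn_integral) auto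
  have "(\<integral>u. (if 1/2 \<le> u then 1 / u else 0) \<partial>beta_dist b)
      = (\<integral>u. beta_density b u * (if 1/2 \<le> u then 1 / u else 0) \<partial>lborel)"
    by (rule beta_dist_integral) measurable
  also have "\<dots> = (\<integral>u. (indicator {1/2..1} u * ?f u) / Beta b (1 - b) \<partial>lborel)"
  proof (rule Bochner_Integration.integral_cong)
    fix u :: real
    show "beta_density b u * (if 1/2 \<le> u then 1 / u else 0) = (indicator {1/2..1} u * ?f u) / Beta b (1 - b)"
    proof (cases "1/2 \<le> u \<and> u \<le> 1")
      case True
      then have "u powr (b - 1) = u powr (b - 2) * u"
        using powr_add[of u "b - 2" 1] by simp
      then show ?thesis using True by (simp add: beta_density_def)
    qed (auto simp: beta_density_def indicator_def)
  qed simp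
  also have "\<dots> = (1 / (1 - b)) / (pi / sin (pi * b))"
    using hb b by (simp add: has_bochner_integral_iff Beta_complement_real)
  finally show ?thesis by simp
qed

end

section \<open>The Stieltjes transform of the image of \<open>F\<close> under squaring, at the point
  \<open>x\<^sup>2\<close>, and its law on the unit interval\<close>

definition stieltjes :: "real measure \<Rightarrow> real \<Rightarrow> real" where
  "stieltjes F x = (\<integral>t. 1 / (x\<^sup>2 + t\<^sup>2) \<partial>F)"

text \<open>The variable \<open>u\<close> rescales and compactifies \<open>t\<close>: u = 1 is t =
  0, u = 1/2 is |t| = x, and u near 0 means that |t| is much larger than x.\<close>

definition stieltjes_law :: "real measure \<Rightarrow> real \<Rightarrow> real measure" where
  "stieltjes_law F x = distr (density F (\<lambda>t. ennreal (1 / ((x\<^sup>2 + t\<^sup>2) * stieltjes F x)))) borel (\<lambda>t. x\<^sup>2 / (x\<^sup>2 + t\<^sup>2))"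

context
  fixes F :: "real measure"
  assumes finF: "finite_measure F" and setsF [measurable_cong]: "sets F = sets borel"
begin

lemma stieltjes_kernel_integrable:
  assumes "x > 0"
  shows "integrable F (\<lambda>t. 1 / (x\<^sup>2 + t\<^sup>2))"
proof -
  interpret finite_measure F by (rule finF)
  show ?thesis
  proof (rule integrable_const_bound[of _ "1 / x\<^sup>2"])
    show "AE t in F. norm (1 / (x\<^sup>2 + t\<^sup>2)) \<le> 1 / x\<^sup>2"
      using assms by (intro always_eventually allI) (auto intro!: frac_le simp: add_pos_nonneg)
  qed measurable
qed

lemma stieltjes_nonneg: "stieltjes F x \<ge> 0"
  unfolding stieltjes_def by (intro integral_nonneg_AE) simp

text \<open>The kernel is strictly positive, so a zero value at one \<open>x\<close> makes
  \<open>F\<close> null and the transform zero everywhere.\<close>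

lemma stieltjes_pos:
  assumes "x0 > 0" "stieltjes F x0 \<noteq> 0" "x > 0"
  shows "stieltjes F x > 0"
proof -
  have "stieltjes F x \<noteq> 0"
  proof
    assume "stieltjes F x = 0"
    then have "AE t in F. 1 / (x\<^sup>2 + t\<^sup>2) = 0"
      unfolding stieltjes_def using stieltjes_kernel_integrable[OF \<open>x > 0\<close>]
      by (subst (asm) integral_nonneg_eq_0_iff_AE) auto
    then have "AE t in F. 1 / (x0\<^sup>2 + t\<^sup>2) = 0"
      by eventually_elim (use \<open>x > 0\<close> in \<open>auto simp: add_nonneg_eq_0_iff\<close>)
    then have "stieltjes F x0 = (\<integral>t. 0 \<partial>F)"
      unfolding stieltjes_def by (intro integral_cong_AE) auto
    then show False using assms by simp
  qed
  then show ?thesis using stieltjes_nonneg[of x] by simp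
qed

lemma stieltjes_law_integral:
  fixes f :: "real \<Rightarrow> real"
  assumes [measurable]: "f \<in> borel_measurable borel"
  shows "integral\<^sup>L (stieltjes_law F x) f = (\<integral>t. f (x\<^sup>2 / (x\<^sup>2 + t\<^sup>2)) / (x\<^sup>2 + t\<^sup>2) \<partial>F) / stieltjes F x"
proof -
  have "integral\<^sup>L (stieltjes_law F x) f
      = (\<integral>t. f (x\<^sup>2 / (x\<^sup>2 + t\<^sup>2)) \<partial>density F (\<lambda>t. ennreal (1 / ((x\<^sup>2 + t\<^sup>2) * stieltjes F x))))"
    unfolding stieltjes_law_def by (rule integral_distr) measurable
  also have "\<dots> = (\<integral>t. (1 / ((x\<^sup>2 + t\<^sup>2) * stieltjes F x)) *\<^sub>R f (x\<^sup>2 / (x\<^sup>2 + t\<^sup>2)) \<partial>F)"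
    using stieltjes_nonneg[of x] by (intro integral_density) auto
  also have "\<dots> = (\<integral>t. f (x\<^sup>2 / (x\<^sup>2 + t\<^sup>2)) / (x\<^sup>2 + t\<^sup>2) / stieltjes F x \<partial>F)"
    by (intro Bochner_Integration.integral_cong) auto
  finally show ?thesis by (simp only: integral_divide_zero)
qed

lemma unit_distribution_stieltjes_law:
  assumes "x > 0" "stieltjes F x > 0"
  shows "unit_distribution (stieltjes_law F x)"
proof -
  let ?d = "density F (\<lambda>t. ennreal (1 / ((x\<^sup>2 + t\<^sup>2) * stieltjes F x)))"
  have "(\<integral>\<^sup>+t. ennreal (1 / ((x\<^sup>2 + t\<^sup>2) * stieltjes F x)) \<partial>F) = (\<integral>\<^sup>+t. ennreal (1 / (x\<^sup>2 + t\<^sup>2) / stieltjes F x) \<partial>F)"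
    by (simp only: divide_divide_eq_left)
  also have "\<dots> = ennreal (\<integral>t. 1 / (x\<^sup>2 + t\<^sup>2) / stieltjes F x \<partial>F)"
    using stieltjes_kernel_integrable[OF assms(1)] assms
    by (intro nn_integral_eq_integral integrable_divide_zero AE_I2) auto
  also have "\<dots> = 1" using assms by (simp only: integral_divide_zero stieltjes_def[symmetric]) simp
  finally have "emeasure ?d (space ?d) = 1"
    by (simp add: emeasure_density)
  then have "prob_space ?d" by (rule prob_spaceI)
  then have "prob_space (stieltjes_law F x)"
    unfolding stieltjes_law_def by (rule prob_space.prob_space_distr) measurable
  then have "real_distribution (stieltjes_law F x)"
    by (simp add: real_distribution_def real_distribution_axioms_def stieltjes_law_def)
  moreover have "AE u in stieltjes_law F x. u \<in> {0..1}"
    unfolding stieltjes_law_def using assms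
    by (subst AE_distr_iff) (auto simp: add_pos_nonneg)
  ultimately show ?thesis by (simp add: unit_distribution_def)
qed

text \<open>Multiplying 1 + au by x^2 + t^2 gives (1 + a) x^2 + t^2, so the resolvent parameter acts
  as a dilation of \<open>x\<close>.\<close>

lemma stieltjes_law_resolvent:
  assumes "x > 0" "a > 0"
  shows "(\<integral>u. 1 / (1 + a * u) \<partial>stieltjes_law F x) = stieltjes F (sqrt (1 + a) * x) / stieltjes F x"
proof -
  have "(\<integral>t. 1 / (1 + a * (x\<^sup>2 / (x\<^sup>2 + t\<^sup>2))) / (x\<^sup>2 + t\<^sup>2) \<partial>F) = stieltjes F (sqrt (1 + a) * x)"
    unfolding stieltjes_def
  proof (rule Bochner_Integration.integral_cong)
    fix t :: real
    have "x\<^sup>2 + t\<^sup>2 > 0" using assms by (simp add: add_pos_nonneg)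
    then have "(1 + a * (x\<^sup>2 / (x\<^sup>2 + t\<^sup>2))) * (x\<^sup>2 + t\<^sup>2) = (sqrt (1 + a) * x)\<^sup>2 + t\<^sup>2"
      using assms by (simp add: power_mult_distrib field_simps)
    then show "1 / (1 + a * (x\<^sup>2 / (x\<^sup>2 + t\<^sup>2))) / (x\<^sup>2 + t\<^sup>2) = 1 / ((sqrt (1 + a) * x)\<^sup>2 + t\<^sup>2)"
      by (simp add: divide_divide_eq_left)
  qed simp
  then show ?thesis by (subst stieltjes_law_integral) auto
qed

text \<open>Along every sequence decreasing to 0 or merely tending to it from the right, regular
  variation makes the resolvents converge to those of the Beta law. Its lack of atoms allows the
  possible discontinuity of \<open>f\<close> at \<open>d\<close>.\<close>

lemma stieltjes_regular_variation_weak_limit: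
  fixes f :: "real \<Rightarrow> real"
  assumes rv: "\<And>c. c > 0 \<Longrightarrow> ((\<lambda>x. stieltjes F (c * x) / stieltjes F x) \<longlongrightarrow> c powr (- \<gamma>)) (at_right 0)"
    and \<gamma>: "0 < \<gamma>" "\<gamma> < 2"
    and f: "f \<in> borel_measurable borel" "\<And>u. \<bar>f u\<bar> \<le> B" "{u. \<not> isCont f u} \<subseteq> {d}"
  shows "((\<lambda>x. (\<integral>t. f (x\<^sup>2 / (x\<^sup>2 + t\<^sup>2)) / (x\<^sup>2 + t\<^sup>2) \<partial>F) / stieltjes F x) \<longlongrightarrow> integral\<^sup>L (beta_dist (\<gamma> / 2)) f) (at_right 0)"
proof -
  have b: "0 < \<gamma> / 2" "\<gamma> / 2 < 1" using \<gamma> by auto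
  \<comment> \<open>If the transform vanished, division by zero would make the ratio 0, while
    \<open>rv\<close> at c = 1 demands the limit 1.\<close>
  have "\<exists>x>0. stieltjes F x \<noteq> 0"
  proof (rule ccontr)
    assume "\<not> ?thesis"
    then have "\<forall>\<^sub>F x in at_right 0. stieltjes F (1 * x) / stieltjes F x = 0"
      by (intro eventually_at_right_less[THEN eventually_mono]) auto
    then have "((\<lambda>x. stieltjes F (1 * x) / stieltjes F x) \<longlongrightarrow> 0) (at_right 0)"
      by (rule tendsto_eventually)
    from tendsto_unique[OF _ this rv[of 1]] show False by simp
  qed
  then have pos: "stieltjes F x > 0" if "x > 0" for x
    using stieltjes_pos that by blast
  show ?thesis
  proof (rule tendsto_at_right_sequentially[of 0 1])
    fix S :: "nat \<Rightarrow> real"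
    assume S: "\<And>n. 0 < S n" "S \<longlonglongrightarrow> 0"
    have S0: "filterlim S (at_right 0) sequentially"
      using S by (intro tendsto_imp_filterlim_at_right) auto
    have N: "unit_distribution (stieltjes_law F (S n))" for n
      using S pos by (intro unit_distribution_stieltjes_law) auto
    note M = unit_distribution_beta_dist[OF b]
    have "weak_conv_m (\<lambda>n. stieltjes_law F (S n)) (beta_dist (\<gamma> / 2))"
    proof (rule weak_conv_of_resolvents[OF N M])
      fix a :: real assume a: "0 < a" "a < 1"
      have "sqrt (1 + a) powr (- \<gamma>) = (1 + a) powr (- (\<gamma> / 2))"
        using a by (simp add: powr_half_sqrt[symmetric] powr_powr)
      then show "(\<lambda>n. \<integral>u. 1 / (1 + a * u) \<partial>stieltjes_law F (S n)) \<longlonglongrightarrow> (\<integral>u. 1 / (1 + a * u) \<partial>beta_dist (\<gamma> / 2))"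
        using filterlim_compose[OF rv[of "sqrt (1 + a)"] S0] a S(1)
        by (simp add: beta_dist_resolvent[OF b] stieltjes_law_resolvent)
    qed
    from weak_conv_imp_bdd_ae_continuous_conv[OF _ _ this beta_dist_subsingleton_null[OF b f(3)], of B] f(1,2) N M
    have "(\<lambda>n. integral\<^sup>L (stieltjes_law F (S n)) f) \<longlonglongrightarrow> integral\<^sup>L (beta_dist (\<gamma> / 2)) f"
      by (simp add: unit_distribution_def)
    then show "(\<lambda>n. (\<integral>t. f ((S n)\<^sup>2 / ((S n)\<^sup>2 + t\<^sup>2)) / ((S n)\<^sup>2 + t\<^sup>2) \<partial>F) / stieltjes F (S n)) \<longlonglongrightarrow> integral\<^sup>L (beta_dist (\<gamma> / 2)) f"
      using f(1) by (simp add: stieltjes_law_integral)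
  qed simp
qed

end

section \<open>The squared sinc function and the Fejer kernel in the compactified variable\<close>

definition sinc_sq :: "real \<Rightarrow> real" where
  "sinc_sq x = (sinc x)\<^sup>2"

lemma sinc_sq_0 [simp]: "sinc_sq 0 = 1"
  by (simp add: sinc_sq_def)

lemma sinc_sq_nonneg [simp]: "sinc_sq x \<ge> 0"
  by (simp add: sinc_sq_def)

lemma power2_mult_sinc_sq: "x\<^sup>2 * sinc_sq x = (sin x)\<^sup>2"
  by (simp add: sinc_sq_def power_divide)

lemma sinc_sq_le_1: "sinc_sq x \<le> 1"
proof (cases "x = 0")
  case False
  have "(sin x)\<^sup>2 \<le> x\<^sup>2" using abs_sin_x_le_abs_x[of x] by (simp add: abs_le_square_iff)
  then show ?thesis using False by (simp add: sinc_sq_def power_divide)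
qed simp

lemma sinc_sq_abs [simp]: "sinc_sq \<bar>x\<bar> = sinc_sq x"
  by (simp add: sinc_sq_def abs_if)

lemma isCont_sinc_sq: "isCont sinc_sq x"
  unfolding sinc_sq_def using isCont_sinc by (intro continuous_intros) auto

lemma sinc_sq_measurable [measurable]: "sinc_sq \<in> borel_measurable borel"
  by (intro borel_measurable_continuous_onI continuous_at_imp_continuous_on ballI isCont_sinc_sq)

lemma abs_sin_minus_self_le: "\<bar>sin x - x\<bar> \<le> \<bar>x\<bar> ^ 3 / (6::real)"
  using Maclaurin_sin_bound[of x 3] by (simp add: eval_nat_numeral sin_coeff_def)

lemma sinc_sq_ge:
  assumes "\<bar>y\<bar> \<le> 1/2"
  shows "sinc_sq y \<ge> 1/4"
proof (cases "y = 0")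
  case False
  have "\<bar>y\<bar> ^ 3 = \<bar>y\<bar> * \<bar>y\<bar>\<^sup>2" by (simp add: power3_eq_cube power2_eq_square)
  also have "\<dots> \<le> \<bar>y\<bar> * 1"
    using assms by (intro mult_left_mono power_le_one) auto
  finally have "\<bar>sin y\<bar> \<ge> \<bar>y\<bar> / 2"
    using abs_sin_minus_self_le[of y] by linarith
  then have "(\<bar>y\<bar> / 2)\<^sup>2 \<le> \<bar>sin y\<bar>\<^sup>2" by (intro power_mono) auto
  then show ?thesis using False by (simp add: sinc_sq_def power_divide field_simps)
qed simp

text \<open>For u = x^2/(x^2 + t^2) the root is |t|/x. Up to the weight of
  \<open>stieltjes_law\<close> this is thus the scale-invariant Fejer kernel as a function of
  \<open>u\<close>.\<close>

definition fejer_profile :: "real \<Rightarrow> real" where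
  "fejer_profile u = sinc_sq (sqrt (1 / u - 1) / 2) / u"

lemma fejer_profile_measurable [measurable]: "fejer_profile \<in> borel_measurable borel"
  unfolding fejer_profile_def by measurable

text \<open>For |u| \<ge> 1/2 the bound on \<open>sinc_sq\<close> suffices. For small u the argument
  y has square of order 1/|u|, and y^2 \<open>sinc_sq y\<close> \<le> 1 supplies the missing factor
  |u|. All real u are covered, as the weak limit asks for a global bound.\<close>

lemma fejer_profile_bound: "\<bar>fejer_profile u\<bar> \<le> 8"
proof -
  consider "u = 0" | "1/2 \<le> \<bar>u\<bar>" | "u \<noteq> 0" "\<bar>u\<bar> < 1/2" by linarith
  then show ?thesis
  proof cases
    case 1 then show ?thesis by (simp add: fejer_profile_def)
  next
    case 2
    have "\<bar>fejer_profile u\<bar> \<le> 1 / (1/2)"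
      unfolding fejer_profile_def abs_divide using 2 by (intro frac_le) (auto simp: sinc_sq_le_1)
    then show ?thesis by simp
  next
    case 3
    define y where "y = sqrt (1 / u - 1) / 2"
    \<comment> \<open>The real \<open>sqrt\<close> is odd, so negative arguments, which occur for
      negative \<open>u\<close>, also square to the absolute value.\<close>
    have "(sqrt z)\<^sup>2 = \<bar>z\<bar>" for z
    proof (cases "z \<ge> 0")
      case False
      have "sqrt z = - sqrt (- z)" using real_sqrt_minus[of "- z"] by simp
      then show ?thesis using False by simp
    qed simp
    then have y2: "y\<^sup>2 = \<bar>1 / u - 1\<bar> / 4" by (simp only: y_def power_divide) simp
    have "\<bar>u\<bar> * \<bar>1 / u - 1\<bar> = \<bar>1 - u\<bar>" using 3 by (simp flip: abs_mult add: right_diff_distrib)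
    then have "\<bar>u\<bar> * (4 * y\<^sup>2) = \<bar>1 - u\<bar>" by (simp add: y2)
    then have "\<bar>u\<bar> * (4 * y\<^sup>2) \<ge> 1/2" using 3 by linarith
    then have "sinc_sq y * (1/2) \<le> sinc_sq y * (\<bar>u\<bar> * (4 * y\<^sup>2))" by (intro mult_left_mono) auto
    also have "\<dots> = 4 * \<bar>u\<bar> * (sin y)\<^sup>2" by (simp add: power2_mult_sinc_sq[symmetric])
    also have "\<dots> \<le> 4 * \<bar>u\<bar>" by (simp add: mult_left_le abs_square_le_1)
    finally have "sinc_sq y \<le> 8 * \<bar>u\<bar>" by simp
    then show ?thesis using 3 by (simp add: fejer_profile_def y_def abs_divide divide_le_eq)
  qed
qed

lemma fejer_profile_discont: "{u. \<not> isCont fejer_profile u} \<subseteq> {0}"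
proof -
  have "isCont fejer_profile u" if "u \<noteq> 0" for u
    unfolding fejer_profile_def using that
    by (intro continuous_intros isCont_o2[OF _ isCont_sinc_sq]) auto
  then show ?thesis by auto
qed

lemma fejer_profile_kernel:
  assumes "x > 0"
  shows "fejer_profile (x\<^sup>2 / (x\<^sup>2 + t\<^sup>2)) / (x\<^sup>2 + t\<^sup>2) = sinc_sq (t / (2 * x)) / x\<^sup>2"
proof -
  have pos: "x\<^sup>2 + t\<^sup>2 > 0" using assms by (simp add: add_pos_nonneg)
  have "1 / (x\<^sup>2 / (x\<^sup>2 + t\<^sup>2)) - 1 = (t / x)\<^sup>2"
    using assms by (simp add: field_simps)
  then have "sqrt (1 / (x\<^sup>2 / (x\<^sup>2 + t\<^sup>2)) - 1) / 2 = \<bar>t / (2 * x)\<bar>"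
    by (simp add: abs_mult abs_divide)
  then have "fejer_profile (x\<^sup>2 / (x\<^sup>2 + t\<^sup>2)) = sinc_sq (t / (2 * x)) / (x\<^sup>2 / (x\<^sup>2 + t\<^sup>2))"
    by (simp only: fejer_profile_def sinc_sq_abs)
  then show ?thesis using pos assms by simp
qed

text \<open>For u \<ge> 1/2 the argument of \<open>sinc_sq\<close> is at most 1/2, so the profile
  dominates 1/(4u), whose integral over the upper half is known.\<close>

lemma fejer_profile_beta_integral_pos:
  assumes b: "0 < b" "b < 1"
  shows "integral\<^sup>L (beta_dist b) fejer_profile > 0"
proof -
  let ?g = "\<lambda>u::real. if 1/2 \<le> u then 1 / u else 0"
  note ud = unit_distribution_beta_dist[OF b]
  have g_int: "integrable (beta_dist b) ?g"
    by (rule unit_distribution_integrable[OF ud, of _ 2]) (auto simp: field_simps)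
  have p_int: "integrable (beta_dist b) fejer_profile"
    by (rule unit_distribution_integrable[OF ud, of _ 8]) (auto simp: fejer_profile_bound)
  have "0 < 1/4 * (sin (pi * b) / (pi * (1 - b)))"
    using b by (auto intro!: divide_pos_pos mult_pos_pos sin_gt_zero)
  also have "\<dots> = (\<integral>u. 1/4 * ?g u \<partial>beta_dist b)"
    using beta_dist_integral_upper_half[OF b] by (subst integral_mult_right_zero) (simp only:)
  also have "\<dots> \<le> integral\<^sup>L (beta_dist b) fejer_profile"
  proof (rule integral_mono_AE)
    have "AE u in beta_dist b. u \<in> {0..1}" using ud by (simp add: unit_distribution_def)
    then show "AE u in beta_dist b. 1/4 * ?g u \<le> fejer_profile u"
    proof eventually_elim
      case (elim u)
      show ?case
      proof (cases "1/2 \<le> u")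
        case True
        have "0 \<le> 1 / u - 1" "1 / u - 1 \<le> 1" using True elim by (auto simp: field_simps)
        then have "\<bar>sqrt (1 / u - 1) / 2\<bar> \<le> 1/2" by auto
        from sinc_sq_ge[OF this] have "1/4 / u \<le> fejer_profile u"
          unfolding fejer_profile_def using True by (intro divide_right_mono) auto
        then show ?thesis using True by simp
      qed (use elim in \<open>auto simp: fejer_profile_def\<close>)
    qed
  qed (use g_int p_int in \<open>auto simp del: mult_if_delta\<close>)
  finally show ?thesis .
qed

section \<open>Passing between \<open>specG\<close> and the Stieltjes transform\<close>

lemma nn_integral_stieltjes_kernel_tail:
  assumes "x > 0" "a \<ge> 0"
  shows "(\<integral>\<^sup>+y. ennreal (2 * y / (x\<^sup>2 + y\<^sup>2)\<^sup>2) * indicator {a..} y \<partial>lborel) = ennreal (1 / (x\<^sup>2 + a\<^sup>2))"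
proof -
  have pos: "x\<^sup>2 + y\<^sup>2 > 0" for y using assms by (simp add: add_pos_nonneg)
  have "(\<integral>\<^sup>+y. ennreal (2 * y / (x\<^sup>2 + y\<^sup>2)\<^sup>2) * indicator {a..} y \<partial>lborel) = 0 - (- 1 / (x\<^sup>2 + a\<^sup>2))"
  proof (rule nn_integral_FTC_atLeast)
    show "((\<lambda>y. - 1 / (x\<^sup>2 + y\<^sup>2)) has_real_derivative 2 * y / (x\<^sup>2 + y\<^sup>2)\<^sup>2) (at y)" for y
      using pos[of y] by (auto intro!: derivative_eq_intros simp: power2_eq_square)
    show "((\<lambda>y. - 1 / (x\<^sup>2 + y\<^sup>2)) \<longlongrightarrow> 0) at_top" by real_asymp
  qed (use assms in auto)
  then show ?thesis by simp
qed

context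
  fixes F :: "real measure"
  assumes finF: "finite_measure F" and setsF [measurable_cong]: "sets F = sets borel"
begin

lemma specG_nonneg: "specG F y \<ge> 0"
  by (simp add: specG_def)

lemma specG_mono: "a \<le> b \<Longrightarrow> specG F a \<le> specG F b"
proof -
  interpret finite_measure F by (rule finF)
  show "a \<le> b \<Longrightarrow> specG F a \<le> specG F b"
    unfolding specG_def by (intro finite_measure_mono) auto
qed

lemma specG_measurable [measurable]: "specG F \<in> borel_measurable borel"
  using specG_mono by (intro borel_measurable_mono) (auto simp: mono_def)

lemma specG_le: "specG F y \<le> measure F (space F)"
proof -
  interpret finite_measure F by (rule finF)
  show ?thesis unfolding specG_def by (rule bounded_measure)
qed

text \<open>Layer-cake formula: the kernel is the integral of its derivative over y \<ge> |t|, and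
  Tonelli turns the condition |t| \<le> y into \<open>specG F y\<close>.\<close>

lemma stieltjes_eq_integral_specG:
  assumes "x > 0"
  shows "has_bochner_integral lborel (\<lambda>y. indicator {0..} y * (2 * y / (x\<^sup>2 + y\<^sup>2)\<^sup>2) * specG F y) (stieltjes F x)"
proof -
  interpret F: finite_measure F by (rule finF)
  interpret pair_sigma_finite lborel F
    by (intro pair_sigma_finite.intro sigma_finite_lborel F.sigma_finite_measure)
  let ?k = "\<lambda>y. 2 * y / (x\<^sup>2 + y\<^sup>2)\<^sup>2"
  have "ennreal (stieltjes F x) = (\<integral>\<^sup>+t. ennreal (1 / (x\<^sup>2 + t\<^sup>2)) \<partial>F)"
    unfolding stieltjes_def
    using stieltjes_kernel_integrable[OF finF setsF assms] by (intro nn_integral_eq_integral[symmetric]) auto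
  also have "\<dots> = (\<integral>\<^sup>+t. (\<integral>\<^sup>+y. ennreal (?k y) * indicator {\<bar>t\<bar>..} y \<partial>lborel) \<partial>F)"
    using nn_integral_stieltjes_kernel_tail[OF assms, of "\<bar>t\<bar>" for t] by simp
  also have "\<dots> = (\<integral>\<^sup>+y. (\<integral>\<^sup>+t. ennreal (?k y) * indicator {\<bar>t\<bar>..} y \<partial>F) \<partial>lborel)"
  proof (rule Fubini')
    have "(\<lambda>(y, t). ennreal (?k y) * indicator {\<bar>t\<bar>..} y) = (\<lambda>p. ennreal (?k (fst p)) * indicator {p. \<bar>snd p\<bar> \<le> fst p} p)"
      by (auto simp: fun_eq_iff indicator_def)
    also have "\<dots> \<in> borel_measurable (lborel \<Otimes>\<^sub>M F)" by measurable
    finally show "(\<lambda>(y, t). ennreal (?k y) * indicator {\<bar>t\<bar>..} y) \<in> borel_measurable (lborel \<Otimes>\<^sub>M F)" .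
  qed
  also have "\<dots> = (\<integral>\<^sup>+y. ennreal (indicator {0..} y * ?k y * specG F y) \<partial>lborel)"
  proof (rule nn_integral_cong)
    fix y :: real
    have "(\<integral>\<^sup>+t. ennreal (?k y) * indicator {\<bar>t\<bar>..} y \<partial>F) = (\<integral>\<^sup>+t. ennreal (?k y) * indicator {-y..y} t \<partial>F)"
      by (intro nn_integral_cong) (auto simp: indicator_def)
    also have "\<dots> = ennreal (?k y) * ennreal (specG F y)"
      by (subst nn_integral_cmult_indicator) (auto simp: setsF specG_def F.emeasure_eq_measure)
    also have "\<dots> = ennreal (indicator {0..} y * ?k y * specG F y)"
    proof (cases "y \<ge> 0")
      case True
      then show ?thesis using specG_nonneg by (simp add: ennreal_mult[symmetric])
    next
      case False
      then have "{-y..y} = {}" by auto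
      then show ?thesis using False by (simp add: specG_def)
    qed
    finally show "(\<integral>\<^sup>+t. ennreal (?k y) * indicator {\<bar>t\<bar>..} y \<partial>F) = ennreal (indicator {0..} y * ?k y * specG F y)" .
  qed
  finally show ?thesis
    using specG_nonneg stieltjes_nonneg[OF finF setsF]
    by (intro has_bochner_integral_nn_integral) (auto simp: indicator_def)
qed

text \<open>Dilating \<open>y\<close> puts the transform at \<open>c * x\<close> under the same
  kernel as the one at \<open>x\<close>, so that only \<open>specG\<close> is rescaled and both can
  be compared pointwise.\<close>

lemma stieltjes_scale_eq_integral_specG:
  assumes "x > 0" "c > 0"
  shows "has_bochner_integral lborel (\<lambda>y. indicator {0..} y * (2 * y / (x\<^sup>2 + y\<^sup>2)\<^sup>2) * specG F (c * y)) (c\<^sup>2 * stieltjes F (c * x))"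
proof -
  let ?f = "\<lambda>y. indicator {0..} y * (2 * y / ((c * x)\<^sup>2 + y\<^sup>2)\<^sup>2) * specG F y"
  have "has_bochner_integral lborel (\<lambda>y. ?f (0 + c * y)) (stieltjes F (c * x) /\<^sub>R \<bar>c\<bar>)"
    using stieltjes_eq_integral_specG[of "c * x"] assms
    by (subst lborel_has_bochner_integral_real_affine_iff[symmetric]) auto
  from has_bochner_integral_mult_right[OF this, of "c ^ 3"]
  have "has_bochner_integral lborel (\<lambda>y. c ^ 3 * ?f (0 + c * y)) (c ^ 3 * (stieltjes F (c * x) /\<^sub>R \<bar>c\<bar>))" .
  also have "c ^ 3 * (stieltjes F (c * x) /\<^sub>R \<bar>c\<bar>) = c\<^sup>2 * stieltjes F (c * x)"
    using assms by (simp add: power2_eq_square power3_eq_cube)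
  also have "(\<lambda>y. c ^ 3 * ?f (0 + c * y)) = (\<lambda>y. indicator {0..} y * (2 * y / (x\<^sup>2 + y\<^sup>2)\<^sup>2) * specG F (c * y))"
  proof
    fix y :: real
    have "(c * x)\<^sup>2 + (c * y)\<^sup>2 = c\<^sup>2 * (x\<^sup>2 + y\<^sup>2)" by (simp add: algebra_simps)
    then have "c ^ 3 * (2 * (c * y) / ((c * x)\<^sup>2 + (c * y)\<^sup>2)\<^sup>2) = (c ^ 4 * (2 * y)) / (c ^ 4 * (x\<^sup>2 + y\<^sup>2)\<^sup>2)"
      by (simp add: power_mult_distrib eval_nat_numeral)
    also have "\<dots> = 2 * y / (x\<^sup>2 + y\<^sup>2)\<^sup>2" using assms by simp
    finally have "c ^ 3 * (2 * (c * y) / ((c * x)\<^sup>2 + (c * y)\<^sup>2)\<^sup>2) = 2 * y / (x\<^sup>2 + y\<^sup>2)\<^sup>2" .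
    moreover have "indicator {0..} (c * y) = (indicator {0..} y :: real)"
      using assms by (simp add: indicator_def zero_le_mult_iff)
    moreover have "c ^ 3 * ?f (0 + c * y)
        = indicator {0..} (c * y) * (c ^ 3 * (2 * (c * y) / ((c * x)\<^sup>2 + (c * y)\<^sup>2)\<^sup>2)) * specG F (c * y)"
      by (simp only: add_0 mult_ac)
    ultimately show "c ^ 3 * ?f (0 + c * y) = indicator {0..} y * (2 * y / (x\<^sup>2 + y\<^sup>2)\<^sup>2) * specG F (c * y)"
      by (simp only:)
  qed
  finally show ?thesis .
qed

text \<open>Below some \<open>\<eta>\<close> the values \<open>specG F (c * y)\<close> and
  \<open>r * specG F y\<close> differ by a small multiple of \<open>specG F y\<close>. Above
  \<open>\<eta>\<close> the kernel contributes a bounded amount, which is negligible because the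
  transform tends to infinity.\<close>

lemma specG_regular_variation_imp_stieltjes:
  assumes rv: "\<And>c. c > 0 \<Longrightarrow> ((\<lambda>y. specG F (c * y) / specG F y) \<longlongrightarrow> c powr \<rho>) (at_right 0)"
    and infty: "filterlim (stieltjes F) at_top (at_right 0)"
    and c: "c > 0"
  shows "((\<lambda>x. stieltjes F (c * x) / stieltjes F x) \<longlongrightarrow> c powr (\<rho> - 2)) (at_right 0)"
proof -
  define P where "P = stieltjes F"
  define T where "T = measure F (space F)"
  define r where "r = c powr \<rho>"
  have r: "r > 0" using c by (simp add: r_def)
  have "((\<lambda>x. c\<^sup>2 * P (c * x) / P x) \<longlongrightarrow> r) (at_right 0)"
  proof (rule tendstoI)
    fix e :: real assume e: "e > 0"
    \<comment> \<open>Closeness within \<open>r\<close> forces a nonzero ratio, hence a nonzero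
      denominator, since division by zero would give 0.\<close>
    have ev: "\<forall>\<^sub>F y in at_right 0. \<bar>specG F (c * y) / specG F y - r\<bar> < min (e / 2) r"
      using tendstoD[OF rv[OF c], of "min (e / 2) r"] e r by (simp add: r_def dist_real_def)
    then obtain \<eta> where \<eta>: "\<eta> > 0" "\<And>y. 0 < y \<Longrightarrow> y < \<eta> \<Longrightarrow> \<bar>specG F (c * y) / specG F y - r\<bar> < min (e / 2) r"
      by (auto simp: eventually_at_right_field)
    have small: "\<bar>specG F (c * y) - r * specG F y\<bar> \<le> e / 2 * specG F y" if y: "0 < y" "y < \<eta>" for y
    proof -
      have "specG F y \<noteq> 0" using \<eta>(2)[OF y] r by (auto split: if_splits)
      then have pos: "specG F y > 0" using specG_nonneg[of y] by simp
      have "\<bar>specG F (c * y) - r * specG F y\<bar> = \<bar>specG F (c * y) / specG F y - r\<bar> * specG F y"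
        using pos by (simp add: abs_mult_pos field_simps flip: abs_mult)
      also have "\<dots> \<le> e / 2 * specG F y"
        using \<eta>(2)[OF y] pos by (intro mult_right_mono) auto
      finally show ?thesis .
    qed
    have T: "0 \<le> specG F y" "specG F y \<le> T" for y
      using specG_nonneg specG_le by (auto simp: T_def)
    have all: "\<bar>specG F (c * y) - r * specG F y\<bar> \<le> e / 2 * specG F y + (1 + r) * T * indicator {\<eta>..} y" if "y > 0" for y
    proof (cases "y < \<eta>")
      case False
      have "\<bar>specG F (c * y) - r * specG F y\<bar> \<le> T + r * T"
        using T[of "c * y"] mult_left_mono[OF T(2)[of y], of r] mult_nonneg_nonneg[OF less_imp_le[OF r] T(1)[of y]] r
        by (intro abs_leI) (use T(1)[of "c * y"] in linarith)+
      moreover have "0 \<le> e / 2 * specG F y" using e T by simp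
      ultimately show ?thesis using False by (simp add: algebra_simps)
    qed (use small that in auto)
    have weighted: "\<bar>k * g - r * (k * h)\<bar> \<le> d * (k * h) + C * (k * i)"
      if "k \<ge> 0" "\<bar>g - r * h\<bar> \<le> d * h + C * i" for k g h d C i :: real
    proof -
      have "\<bar>k * g - r * (k * h)\<bar> = \<bar>k * (g - r * h)\<bar>" by (simp add: algebra_simps)
      also have "\<dots> = k * \<bar>g - r * h\<bar>" using that(1) by (simp add: abs_mult)
      also have "\<dots> \<le> k * (d * h + C * i)" using that by (intro mult_left_mono)
      finally show ?thesis by (simp add: algebra_simps)
    qed
    have bound: "\<bar>c\<^sup>2 * P (c * x) - r * P x\<bar> \<le> e / 2 * P x + (1 + r) * T * (1 / \<eta>\<^sup>2)" if x: "x > 0" for x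
    proof -
      let ?k = "\<lambda>y. indicator {0..} y * (2 * y / (x\<^sup>2 + y\<^sup>2)\<^sup>2)"
      note h1 = stieltjes_scale_eq_integral_specG[OF x c, folded P_def]
      note h2 = stieltjes_eq_integral_specG[OF x, folded P_def]
      have h3: "has_bochner_integral lborel (\<lambda>y. ?k y * indicator {\<eta>..} y) (1 / (x\<^sup>2 + \<eta>\<^sup>2))"
      proof (rule has_bochner_integral_nn_integral)
        have "(\<integral>\<^sup>+y. ennreal (?k y * indicator {\<eta>..} y) \<partial>lborel) = (\<integral>\<^sup>+y. ennreal (2 * y / (x\<^sup>2 + y\<^sup>2)\<^sup>2) * indicator {\<eta>..} y \<partial>lborel)"
          using \<eta>(1) by (intro nn_integral_cong) (auto simp: indicator_def)
        then show "(\<integral>\<^sup>+y. ennreal (?k y * indicator {\<eta>..} y) \<partial>lborel) = ennreal (1 / (x\<^sup>2 + \<eta>\<^sup>2))"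
          using nn_integral_stieltjes_kernel_tail[OF x, of \<eta>] \<eta>(1) by simp
      qed (auto simp: indicator_def)
      have d: "has_bochner_integral lborel (\<lambda>y. ?k y * specG F (c * y) - r * (?k y * specG F y)) (c\<^sup>2 * P (c * x) - r * P x)"
        by (intro has_bochner_integral_diff has_bochner_integral_mult_right h1 h2)
      have u: "has_bochner_integral lborel (\<lambda>y. e / 2 * (?k y * specG F y) + (1 + r) * T * (?k y * indicator {\<eta>..} y))
          (e / 2 * P x + (1 + r) * T * (1 / (x\<^sup>2 + \<eta>\<^sup>2)))"
        by (intro has_bochner_integral_add has_bochner_integral_mult_right h2 h3)
      have "\<bar>c\<^sup>2 * P (c * x) - r * P x\<bar> = \<bar>\<integral>y. ?k y * specG F (c * y) - r * (?k y * specG F y) \<partial>lborel\<bar>"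
        using has_bochner_integral_integral_eq[OF d] by simp
      also have "\<dots> \<le> (\<integral>y. \<bar>?k y * specG F (c * y) - r * (?k y * specG F y)\<bar> \<partial>lborel)"
        by (rule integral_abs_bound)
      also have "\<dots> \<le> (\<integral>y. e / 2 * (?k y * specG F y) + (1 + r) * T * (?k y * indicator {\<eta>..} y) \<partial>lborel)"
      proof (rule integral_mono)
        show "integrable lborel (\<lambda>y. \<bar>?k y * specG F (c * y) - r * (?k y * specG F y)\<bar>)"
          using d by (intro integrable_abs) (simp add: has_bochner_integral_iff)
        show "integrable lborel (\<lambda>y. e / 2 * (?k y * specG F y) + (1 + r) * T * (?k y * indicator {\<eta>..} y))"
          using u by (simp add: has_bochner_integral_iff)
        fix y :: real
        show "\<bar>?k y * specG F (c * y) - r * (?k y * specG F y)\<bar> \<le> e / 2 * (?k y * specG F y) + (1 + r) * T * (?k y * indicator {\<eta>..} y)"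
        proof (cases "y > 0")
          case True
          then have k: "?k y \<ge> 0" by simp
          show ?thesis by (rule weighted[OF k all[OF True]])
        qed (auto simp: indicator_def)
      qed
      also have "\<dots> = e / 2 * P x + (1 + r) * T * (1 / (x\<^sup>2 + \<eta>\<^sup>2))"
        using u by (rule has_bochner_integral_integral_eq)
      also have "\<dots> \<le> e / 2 * P x + (1 + r) * T * (1 / \<eta>\<^sup>2)"
        using r T[of 0] \<eta>(1) by (intro add_left_mono mult_left_mono frac_le) auto
      finally show ?thesis .
    qed
    \<comment> \<open>The first entry makes the transform positive; the second makes the tail at
      most e/4 of it, giving 3e/4 in total.\<close>
    define Z where "Z = max 1 (4 / e * ((1 + r) * T * (1 / \<eta>\<^sup>2)))"
    have "\<forall>\<^sub>F x in at_right 0. P x \<ge> Z"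
      using infty by (simp add: filterlim_at_top P_def)
    then show "\<forall>\<^sub>F x in at_right 0. dist (c\<^sup>2 * P (c * x) / P x) r < e"
      using eventually_at_right_less[of 0]
    proof eventually_elim
      case (elim x)
      have Px: "P x > 0" "P x \<ge> 4 / e * ((1 + r) * T * (1 / \<eta>\<^sup>2))"
        using elim by (auto simp: Z_def)
      have "(1 + r) * T * (1 / \<eta>\<^sup>2) = e / 4 * (4 / e * ((1 + r) * T * (1 / \<eta>\<^sup>2)))"
        using e by simp
      also have "\<dots> \<le> e / 4 * P x" using Px(2) e by (intro mult_left_mono) auto
      finally have "\<bar>c\<^sup>2 * P (c * x) - r * P x\<bar> \<le> e / 2 * P x + e / 4 * P x"
        using bound[of x] elim by linarith
      also have "\<dots> < e * P x" using e Px(1) by (simp add: field_simps)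
      finally have "\<bar>c\<^sup>2 * P (c * x) - r * P x\<bar> / P x < e" using Px(1) by (simp add: divide_less_eq)
      moreover have "\<bar>c\<^sup>2 * P (c * x) - r * P x\<bar> / P x = \<bar>c\<^sup>2 * P (c * x) / P x - r\<bar>"
        using Px(1) by (subst abs_div_pos) (auto simp: diff_divide_distrib)
      ultimately show ?case by (simp add: dist_real_def)
    qed
  qed
  from tendsto_divide[OF this tendsto_const[of "c\<^sup>2"]] c
  have "((\<lambda>x. P (c * x) / P x) \<longlongrightarrow> r / c\<^sup>2) (at_right 0)"
    by (simp add: mult.commute)
  also have "r / c\<^sup>2 = c powr (\<rho> - 2)"
    using c by (simp add: r_def powr_diff)
  finally show ?thesis by (simp add: P_def)
qed

context
  fixes \<gamma> :: real
  assumes \<gamma>: "0 < \<gamma>" "\<gamma> < 2"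
    and rv: "\<And>c. c > 0 \<Longrightarrow> ((\<lambda>x. stieltjes F (c * x) / stieltjes F x) \<longlongrightarrow> c powr (- \<gamma>)) (at_right 0)"
begin

text \<open>The test function 1/u on u \<ge> 1/2 cancels the weight: it turns 1/(x^2 + t^2) into
  1/x^2 exactly on |t| \<le> x. Its only jump is at u = 1/2.\<close>

lemma specG_div_stieltjes_limit:
  "((\<lambda>x. specG F x / (x\<^sup>2 * stieltjes F x)) \<longlongrightarrow> sin (\<gamma> * pi / 2) / (pi * (1 - \<gamma> / 2))) (at_right 0)"
proof -
  let ?f = "\<lambda>u::real. if 1/2 \<le> u then 1 / u else 0"
  have "((\<lambda>x. (\<integral>t. ?f (x\<^sup>2 / (x\<^sup>2 + t\<^sup>2)) / (x\<^sup>2 + t\<^sup>2) \<partial>F) / stieltjes F x) \<longlongrightarrow> integral\<^sup>L (beta_dist (\<gamma> / 2)) ?f) (at_right 0)"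
  proof (rule stieltjes_regular_variation_weak_limit[OF finF setsF rv \<gamma>])
    show "\<bar>?f u\<bar> \<le> 2" for u by (auto simp: field_simps)
    have "isCont ?f u" if "u \<noteq> 1/2" for u
    proof (cases "u < 1/2")
      case True
      then have "\<forall>\<^sub>F v in nhds u. ?f v = 0"
        by (intro eventually_mono[OF eventually_nhds_in_open[of "{..<1/2}"]]) auto
      then show ?thesis by (subst isCont_cong) auto
    next
      case False
      with that have u: "u > 1/2" by simp
      then have "\<forall>\<^sub>F v in nhds u. ?f v = 1 / v"
        by (intro eventually_mono[OF eventually_nhds_in_open[of "{1/2<..}"]]) auto
      then show ?thesis using u by (subst isCont_cong) (auto intro!: continuous_intros)
    qed
    then show "{u. \<not> isCont ?f u} \<subseteq> {1/2}" by blast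
  qed measurable
  moreover have "\<forall>\<^sub>F x in at_right 0. (\<integral>t. ?f (x\<^sup>2 / (x\<^sup>2 + t\<^sup>2)) / (x\<^sup>2 + t\<^sup>2) \<partial>F) / stieltjes F x = specG F x / (x\<^sup>2 * stieltjes F x)"
    using eventually_at_right_less[of 0]
  proof eventually_elim
    case (elim x)
    have "(\<integral>t. ?f (x\<^sup>2 / (x\<^sup>2 + t\<^sup>2)) / (x\<^sup>2 + t\<^sup>2) \<partial>F) = (\<integral>t. indicator {-x..x} t / x\<^sup>2 \<partial>F)"
    proof (rule Bochner_Integration.integral_cong)
      fix t :: real
      have pos: "x\<^sup>2 + t\<^sup>2 > 0" using elim by (simp add: add_pos_nonneg)
      have "1/2 \<le> x\<^sup>2 / (x\<^sup>2 + t\<^sup>2) \<longleftrightarrow> t\<^sup>2 \<le> x\<^sup>2"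
        using pos by (auto simp: le_divide_eq)
      also have "\<dots> \<longleftrightarrow> t \<in> {-x..x}"
        using elim by (auto simp flip: abs_le_square_iff)
      finally have "1/2 \<le> x\<^sup>2 / (x\<^sup>2 + t\<^sup>2) \<longleftrightarrow> t \<in> {-x..x}" .
      then show "?f (x\<^sup>2 / (x\<^sup>2 + t\<^sup>2)) / (x\<^sup>2 + t\<^sup>2) = indicator {-x..x} t / x\<^sup>2"
        using pos elim by (simp add: indicator_def del: atLeastAtMost_iff)
    qed simp
    also have "\<dots> = specG F x / x\<^sup>2" by (simp add: specG_def setsF)
    finally show ?case by (simp only: divide_divide_eq_left)
  qed
  ultimately have "((\<lambda>x. specG F x / (x\<^sup>2 * stieltjes F x)) \<longlongrightarrow> integral\<^sup>L (beta_dist (\<gamma> / 2)) ?f) (at_right 0)"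
    by (rule Lim_transform_eventually)
  then show ?thesis
    using beta_dist_integral_upper_half[of "\<gamma> / 2"] \<gamma> by (simp add: mult.commute)
qed

lemma fejer_div_stieltjes_limit:
  "((\<lambda>x. (\<integral>t. sinc_sq (t / (2 * x)) / x\<^sup>2 \<partial>F) / stieltjes F x) \<longlongrightarrow> integral\<^sup>L (beta_dist (\<gamma> / 2)) fejer_profile) (at_right 0)"
proof (rule Lim_transform_eventually)
  show "((\<lambda>x. (\<integral>t. fejer_profile (x\<^sup>2 / (x\<^sup>2 + t\<^sup>2)) / (x\<^sup>2 + t\<^sup>2) \<partial>F) / stieltjes F x) \<longlongrightarrow> integral\<^sup>L (beta_dist (\<gamma> / 2)) fejer_profile) (at_right 0)"
    by (rule stieltjes_regular_variation_weak_limit[OF finF setsF rv \<gamma> _ fejer_profile_bound fejer_profile_discont]) measurable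
  show "\<forall>\<^sub>F x in at_right 0. (\<integral>t. fejer_profile (x\<^sup>2 / (x\<^sup>2 + t\<^sup>2)) / (x\<^sup>2 + t\<^sup>2) \<partial>F) / stieltjes F x
      = (\<integral>t. sinc_sq (t / (2 * x)) / x\<^sup>2 \<partial>F) / stieltjes F x"
    using eventually_at_right_less[of 0] by eventually_elim (simp add: fejer_profile_kernel)
qed

end

end

section \<open>The Fejer kernel\<close>

text \<open>The squared modulus avoids the quotient of sines, which is undefined at t = 0, and is
  what the double covariance sum produces.\<close>

definition fejer :: "nat \<Rightarrow> real \<Rightarrow> real" where
  "fejer n t = (cmod (\<Sum>k=1..n. exp (\<i> * of_real t * of_nat k)))\<^sup>2"

lemma fejer_measurable [measurable]: "fejer n \<in> borel_measurable borel"
  unfolding fejer_def by measurable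

lemma fejer_nonneg [simp]: "fejer n t \<ge> 0"
  by (simp add: fejer_def)

lemma fejer_le: "fejer n t \<le> (real n)\<^sup>2"
proof -
  have "cmod (\<Sum>k=1..n. exp (\<i> * of_real t * of_nat k)) \<le> (\<Sum>k=1..n. 1)"
    by (rule sum_norm_le) (simp add: norm_exp_eq_Re)
  then show ?thesis unfolding fejer_def by (intro power_mono) auto
qed

lemma fejer_at_0: "fejer n 0 = (real n)\<^sup>2"
  by (simp add: fejer_def)

text \<open>The geometric sum telescopes after multiplication by \<open>?z - 1\<close>, and chords
  of the unit circle are twice the sine of the half angle. The product form avoids division at the
  zeros of the sine.\<close>

lemma fejer_sin_half: "fejer n t * (4 * (sin (t / 2))\<^sup>2) = 4 * (sin (real n * t / 2))\<^sup>2"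
proof -
  let ?z = "exp (\<i> * of_real t)"
  have pow: "exp (\<i> * of_real t * of_nat k) = ?z ^ k" for k
    by (simp add: exp_of_nat_mult[symmetric] mult_ac)
  have "(\<Sum>k=1..n. ?z ^ k) = ?z * (\<Sum>k<n. ?z ^ k)"
    by (simp add: sum.atLeast1_atMost_eq sum_distrib_left)
  then have "(?z - 1) * (\<Sum>k=1..n. ?z ^ k) = ?z * (?z ^ n - 1)"
    by (simp add: power_diff_1_eq mult_ac)
  then have "cmod (?z - 1) * cmod (\<Sum>k=1..n. ?z ^ k) = cmod (?z ^ n - 1)"
    by (metis norm_mult norm_exp_i_times mult_1)
  moreover have "cmod (?z - 1) = 2 * \<bar>sin (t / 2)\<bar>"
    by (rule dist_exp_i_1)
  moreover have "cmod (?z ^ n - 1) = 2 * \<bar>sin (real n * t / 2)\<bar>"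
    using dist_exp_i_1[of "real n * t"] by (simp add: exp_of_nat_mult[symmetric] mult_ac)
  ultimately have "(2 * \<bar>sin (t / 2)\<bar> * cmod (\<Sum>k=1..n. ?z ^ k))\<^sup>2 = (2 * \<bar>sin (real n * t / 2)\<bar>)\<^sup>2"
    by metis
  then show ?thesis unfolding fejer_def pow by (simp add: power_mult_distrib mult_ac)
qed

text \<open>The singularities of 1/(4 sin^2(t/2)) and 1/t^2 cancel at the origin, by the cubic
  Taylor bound for the sine. This lets sine kernels be replaced by powers at bounded cost.\<close>

lemma sin_half_sq_bounds:
  assumes "t \<noteq> 0" "\<bar>t\<bar> \<le> pi"
  shows "0 < 4 * (sin (t / 2))\<^sup>2" "4 * (sin (t / 2))\<^sup>2 \<le> t\<^sup>2"
    "1 / (4 * (sin (t / 2))\<^sup>2) - 1 / t\<^sup>2 \<le> 1"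
proof -
  define x s where "x = \<bar>t / 2\<bar>" and "s = \<bar>sin (t / 2)\<bar>"
  have x: "x > 0" "x \<le> 2" using assms pi_half_less_two by (auto simp: x_def)
  have sx: "s \<le> x" using abs_sin_x_le_abs_x[of "t / 2"] by (simp add: s_def x_def)
  \<comment> \<open>Here x \<le> 2 bounds the Taylor error by 2x/3, leaving s \<ge> x/3.\<close>
  have "x ^ 3 / 6 \<le> x * 4 / 6"
    using x power_mono[of x 2 2] by (simp add: power3_eq_cube power2_eq_square mult_left_mono)
  moreover have d: "x - s \<le> x ^ 3 / 6"
    using abs_sin_minus_self_le[of "t / 2"] unfolding x_def s_def by linarith
  ultimately have s3: "s \<ge> x / 3" by linarith
  then have s: "s > 0" using x by linarith
  have eqs: "4 * (sin (t / 2))\<^sup>2 = 4 * s\<^sup>2" "t\<^sup>2 = 4 * x\<^sup>2"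
    by (simp_all add: s_def x_def power_divide)
  show "0 < 4 * (sin (t / 2))\<^sup>2" using s eqs by simp
  show "4 * (sin (t / 2))\<^sup>2 \<le> t\<^sup>2" unfolding eqs using sx s by (simp add: power_mono)
  have "x\<^sup>2 - s\<^sup>2 = (x - s) * (x + s)" by (simp add: power2_eq_square algebra_simps)
  also have "\<dots> \<le> (x ^ 3 / 6) * (2 * x)" using d sx s x by (intro mult_mono) auto
  also have "\<dots> = 3 * (x\<^sup>2 * (x / 3)\<^sup>2)" by (simp add: eval_nat_numeral)
  also have "\<dots> \<le> 4 * (x\<^sup>2 * s\<^sup>2)" using s3 x by (intro mult_mono power_mono) auto
  finally have "(x\<^sup>2 - s\<^sup>2) / (4 * (x\<^sup>2 * s\<^sup>2)) \<le> 1" using x s by (simp add: divide_le_eq)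
  also have "(x\<^sup>2 - s\<^sup>2) / (4 * (x\<^sup>2 * s\<^sup>2)) = 1 / (4 * s\<^sup>2) - 1 / (4 * x\<^sup>2)"
    using x s by (simp add: field_simps)
  finally show "1 / (4 * (sin (t / 2))\<^sup>2) - 1 / t\<^sup>2 \<le> 1" by (simp only: eqs)
qed

text \<open>The two kernels are 4 sin^2(nt/2) times 1/q and 1/t^2, so they differ by at most 4,
  uniformly in \<open>n\<close>.\<close>

lemma fejer_sinc_bounds:
  assumes "\<bar>t\<bar> \<le> pi"
  shows "\<bar>fejer n t - (real n)\<^sup>2 * sinc_sq (real n * t / 2)\<bar> \<le> 4"
proof (cases "t = 0")
  case True
  then show ?thesis by (simp add: fejer_at_0)
next
  case False
  note s = sin_half_sq_bounds[OF False assms]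
  define q where "q = 4 * (sin (t / 2))\<^sup>2"
  have q: "0 < q" "q \<le> t\<^sup>2" "1 / q - 1 / t\<^sup>2 \<le> 1" using s by (simp_all only: q_def)
  have f: "fejer n t = 4 * (sin (real n * t / 2))\<^sup>2 * (1 / q)"
    using fejer_sin_half[of n t] q(1) by (simp add: q_def field_simps)
  have "(real n * t / 2)\<^sup>2 * sinc_sq (real n * t / 2) = (sin (real n * t / 2))\<^sup>2"
    by (rule power2_mult_sinc_sq)
  then have w: "(real n)\<^sup>2 * sinc_sq (real n * t / 2) = 4 * (sin (real n * t / 2))\<^sup>2 * (1 / t\<^sup>2)"
    using False by (simp add: power_mult_distrib power_divide field_simps)
  have "0 \<le> 1 / q - 1 / t\<^sup>2" using q by (simp add: frac_le)
  moreover have "(sin (real n * t / 2))\<^sup>2 \<le> 1" by (simp add: abs_square_le_1)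
  ultimately have "0 \<le> 4 * (sin (real n * t / 2))\<^sup>2 * (1 / q - 1 / t\<^sup>2)"
    "4 * (sin (real n * t / 2))\<^sup>2 * (1 / q - 1 / t\<^sup>2) \<le> 4 * 1 * 1"
    using q(3) by (simp, intro mult_mono) auto
  then show ?thesis unfolding f w by (simp add: right_diff_distrib)
qed

text \<open>After multiplication by q = 2 - 2 cos t the kernel becomes 2 - 2 cos(kt). The cosine
  part solves the homogeneous recurrence, and the constant part contributes 2q.\<close>

lemma fejer_recurrence:
  assumes "\<bar>t\<bar> \<le> pi"
  shows "fejer (n + 2) t - 2 * cos t * fejer (n + 1) t + fejer n t = 2"
proof (cases "t = 0")
  case True
  then show ?thesis by (simp add: fejer_at_0 power2_eq_square algebra_simps)
next
  case False
  define q where "q = 4 * (sin (t / 2))\<^sup>2"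
  have q: "q > 0" using sin_half_sq_bounds(1)[OF False assms] by (simp only: q_def)
  have half: "4 * (sin (y / 2))\<^sup>2 = 2 - 2 * cos y" for y :: real
    using cos_double_sin[of "y / 2"] by simp
  have f: "fejer k t * q = 2 - 2 * cos (real k * t)" for k
    using fejer_sin_half[of k t] half[of "real k * t"] by (simp add: q_def)
  have qc: "q = 2 - 2 * cos t" using half[of t] by (simp add: q_def)
  have "cos (real (n + 2) * t) + cos (real n * t) = 2 * cos t * cos (real (n + 1) * t)"
  proof -
    have "real (n + 2) * t = real (n + 1) * t + t" "real n * t = real (n + 1) * t - t"
      by (simp_all add: algebra_simps)
    then show ?thesis by (simp only: cos_add cos_diff) simp
  qed
  then have "(fejer (n + 2) t - 2 * cos t * fejer (n + 1) t + fejer n t) * q = 2 * q"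
    by (simp only: distrib_right left_diff_distrib mult.assoc f) (simp add: qc algebra_simps)
  then show ?thesis using q by simp
qed

section \<open>Exponential sums of the Fejer kernel\<close>

lemma summable_square_exp:
  assumes "\<delta> > 0"
  shows "summable (\<lambda>n. (real n)\<^sup>2 * exp (- (\<delta> * real n)))"
proof (rule summable_comparison_test')
  show "summable (\<lambda>n. 8 / \<delta>\<^sup>2 * exp (- (\<delta> / 2)) ^ n)"
    using assms by (intro summable_mult summable_geometric) auto
  fix n :: nat
  \<comment> \<open>Half of the exponential decay absorbs the square, which is the origin of
    8/\<delta>^2 and leaves a geometric series.\<close>
  have "(\<delta> * real n / 2)\<^sup>2 / 2 \<le> exp (\<delta> * real n / 2)"
  proof -
    have "0 \<le> \<delta> * real n / 2" using assms by simp
    from exp_lower_Taylor_quadratic[OF this] this show ?thesis by linarith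
  qed
  then have "(real n)\<^sup>2 \<le> 8 / \<delta>\<^sup>2 * exp (\<delta> * real n / 2)"
    using assms by (simp add: field_simps power2_eq_square)
  then have "(real n)\<^sup>2 * exp (- (\<delta> * real n)) \<le> 8 / \<delta>\<^sup>2 * exp (\<delta> * real n / 2) * exp (- (\<delta> * real n))"
    by (intro mult_right_mono) auto
  also have "\<dots> = 8 / \<delta>\<^sup>2 * exp (- (\<delta> / 2)) ^ n"
    by (simp add: mult_exp_exp exp_of_nat_mult[symmetric] mult_ac)
  finally show "norm ((real n)\<^sup>2 * exp (- (\<delta> * real n))) \<le> 8 / \<delta>\<^sup>2 * exp (- (\<delta> / 2)) ^ n"
    by simp
qed

lemma fejer_exp_summable:
  assumes "\<delta> > 0"
  shows "summable (\<lambda>n. fejer n t * exp (- (\<delta> * real n)))"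
  by (rule summable_comparison_test'[OF summable_square_exp[OF assms]])
     (auto intro!: mult_right_mono fejer_le)

text \<open>This is 4 sinh^2(\<delta>/2), so its square root is asymptotic to \<delta> at 0.\<close>

definition laplace_scale :: "real \<Rightarrow> real" where
  "laplace_scale \<delta> = exp \<delta> + exp (- \<delta>) - 2"

lemma laplace_scale_pos:
  assumes "\<delta> > 0"
  shows "laplace_scale \<delta> > 0"
proof -
  have "laplace_scale \<delta> = (exp (\<delta> / 2) - exp (- (\<delta> / 2)))\<^sup>2"
    by (simp add: laplace_scale_def power2_eq_square algebra_simps mult_exp_exp)
  moreover have "exp (\<delta> / 2) - exp (- (\<delta> / 2)) > 0" using assms by simp
  ultimately show ?thesis by simp
qed

text \<open>Summing the recurrence against powers of \<open>r = exp (- \<delta>)\<close> gives a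
  linear equation for the sum; the initial values are 0 and 1.\<close>

lemma fejer_generating_function:
  assumes "\<delta> > 0" "\<bar>t\<bar> \<le> pi"
  shows "(\<Sum>n. fejer n t * exp (- (\<delta> * real n)))
    = (1 + exp (- \<delta>)) / (1 - exp (- \<delta>)) * (1 / (laplace_scale \<delta> + 4 * (sin (t / 2))\<^sup>2))"
proof -
  define r where "r = exp (- \<delta>)"
  have r: "0 < r" "r < 1" using assms by (auto simp: r_def)
  have er: "exp (- (\<delta> * real n)) = r ^ n" for n
    by (simp add: r_def exp_of_nat_mult[symmetric] mult_ac)
  define f where "f n = fejer n t * r ^ n" for n
  define S where "S = suminf f"
  have summ: "summable f" using fejer_exp_summable[OF assms(1), of t] by (simp add: f_def[abs_def] er)
  have s0: "f sums S" using summ by (simp add: S_def summable_sums)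
  have f0: "f 0 = 0" by (simp add: f_def fejer_def)
  have f1: "f 1 = r" by (simp add: f_def fejer_def)
  have s1: "(\<lambda>n. f (n + 1)) sums S"
    using sums_split_initial_segment[OF s0, of 1] f0 by simp
  have s2: "(\<lambda>n. f (n + 2)) sums (S - r)"
    using sums_split_initial_segment[OF s0, of 2] f0 f1 by (simp add: eval_nat_numeral)
  have "(\<lambda>n. f (n + 2) - 2 * cos t * r * f (n + 1) + r\<^sup>2 * f n) sums ((S - r) - 2 * cos t * r * S + r\<^sup>2 * S)"
    by (intro sums_add sums_diff sums_mult s0 s1 s2)
  moreover have "f (n + 2) - 2 * cos t * r * f (n + 1) + r\<^sup>2 * f n = 2 * r\<^sup>2 * r ^ n" for n
  proof -
    have "f (n + 2) - 2 * cos t * r * f (n + 1) + r\<^sup>2 * f n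
        = (fejer (n + 2) t - 2 * cos t * fejer (n + 1) t + fejer n t) * (r\<^sup>2 * r ^ n)"
      by (simp add: f_def power2_eq_square algebra_simps)
    then show ?thesis using fejer_recurrence[OF assms(2), of n] by simp
  qed
  ultimately have "(\<lambda>n. 2 * r\<^sup>2 * r ^ n) sums ((S - r) - 2 * cos t * r * S + r\<^sup>2 * S)" by simp
  moreover have "(\<lambda>n. 2 * r\<^sup>2 * r ^ n) sums (2 * r\<^sup>2 * (1 / (1 - r)))"
    using r by (intro sums_mult geometric_sums) auto
  ultimately have "(S - r) - 2 * cos t * r * S + r\<^sup>2 * S = 2 * r\<^sup>2 * (1 / (1 - r))"
    by (rule sums_unique2)
  then have eq: "S * (1 - 2 * cos t * r + r\<^sup>2) = r * ((1 + r) / (1 - r))"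
    using r by (simp add: field_simps power2_eq_square)
  have rexp: "r * exp \<delta> = 1" by (simp add: r_def mult_exp_exp)
  have sq: "4 * (sin (t / 2))\<^sup>2 = 2 - 2 * cos t"
    using cos_double_sin[of "t / 2"] by simp
  \<comment> \<open>Extracting the factor \<open>r\<close> makes the denominator symmetric in
    \<delta> and brings it close to \<delta>^2 + t^2.\<close>
  have "1 - 2 * cos t * r + r\<^sup>2 = r * (laplace_scale \<delta> + 4 * (sin (t / 2))\<^sup>2)"
    unfolding sq laplace_scale_def r_def[symmetric] using rexp by (simp add: power2_eq_square algebra_simps)
  with eq have "r * (S * (laplace_scale \<delta> + 4 * (sin (t / 2))\<^sup>2)) = r * ((1 + r) / (1 - r))"
    by (simp add: mult_ac)
  then have Sw: "S * (laplace_scale \<delta> + 4 * (sin (t / 2))\<^sup>2) = (1 + r) / (1 - r)"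
    using r by (subst (asm) mult_left_cancel) auto
  define w where "w = laplace_scale \<delta> + 4 * (sin (t / 2))\<^sup>2"
  have "w > 0"
    using laplace_scale_pos[OF assms(1)] by (simp add: w_def add_pos_nonneg)
  then have "S = (1 + r) / (1 - r) * (1 / w)"
    unfolding Sw[folded w_def, symmetric] by simp
  then show ?thesis by (simp only: S_def f_def[abs_def] er r_def w_def)
qed

section \<open>Comparison estimates for integrals against the spectral measure\<close>

context
  fixes F :: "real measure"
  assumes finF: "finite_measure F" and setsF [measurable_cong]: "sets F = sets borel"
begin

lemma stieltjes_antimono:
  assumes "0 < a" "a \<le> b"
  shows "stieltjes F b \<le> stieltjes F a"
  unfolding stieltjes_def using assms
  by (intro integral_mono stieltjes_kernel_integrable[OF finF setsF] frac_le)
     (auto simp: add_pos_nonneg power_mono)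

lemma stieltjes_le_scaled:
  assumes "0 < a" "a \<le> b"
  shows "stieltjes F a \<le> (b / a)\<^sup>2 * stieltjes F b"
proof -
  have "stieltjes F a \<le> (\<integral>t. (b / a)\<^sup>2 * (1 / (b\<^sup>2 + t\<^sup>2)) \<partial>F)"
    unfolding stieltjes_def
  proof (rule integral_mono)
    fix t :: real
    have "a\<^sup>2 * t\<^sup>2 \<le> b\<^sup>2 * t\<^sup>2" using assms by (intro mult_right_mono power_mono) auto
    moreover have "a\<^sup>2 + t\<^sup>2 > 0" "b\<^sup>2 + t\<^sup>2 > 0" using assms by (auto simp: add_pos_nonneg)
    ultimately show "1 / (a\<^sup>2 + t\<^sup>2) \<le> (b / a)\<^sup>2 * (1 / (b\<^sup>2 + t\<^sup>2))"
      using assms by (simp add: power_divide divide_simps) (simp add: algebra_simps)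
  qed (use assms in \<open>auto intro!: integrable_mult_right stieltjes_kernel_integrable[OF finF setsF] simp del: times_divide_eq_right\<close>)
  then show ?thesis by (simp only: stieltjes_def integral_mult_right_zero)
qed

text \<open>The transform decreases, but by no more than the square of the ratio of the arguments;
  these two bounds squeeze the quotient.\<close>

lemma stieltjes_asymp_arg:
  assumes "\<And>x. x > 0 \<Longrightarrow> b x > 0" and lim: "((\<lambda>x. b x / x) \<longlongrightarrow> 1) (at_right 0)"
    and pos: "\<And>x. x > 0 \<Longrightarrow> stieltjes F x > 0"
  shows "((\<lambda>x. stieltjes F x / stieltjes F (b x)) \<longlongrightarrow> 1) (at_right 0)"
proof (rule tendsto_sandwich)
  have *: "min 1 ((b x / x)\<^sup>2) \<le> stieltjes F x / stieltjes F (b x) \<and> stieltjes F x / stieltjes F (b x) \<le> max 1 ((b x / x)\<^sup>2)"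
    if x: "x > 0" for x
  proof (cases "x \<le> b x")
    case True
    have "1 \<le> stieltjes F x / stieltjes F (b x)"
      using stieltjes_antimono[OF x True] pos[OF assms(1)[OF x]] by simp
    moreover have "stieltjes F x / stieltjes F (b x) \<le> (b x / x)\<^sup>2"
      using stieltjes_le_scaled[OF x True] pos[OF assms(1)[OF x]] by (simp only: divide_le_eq if_True)
    ultimately show ?thesis by auto
  next
    case False
    then have bx: "b x \<le> x" "b x > 0" using assms(1)[OF x] by auto
    have "stieltjes F x / stieltjes F (b x) \<le> 1"
      using stieltjes_antimono[OF bx(2,1)] pos[OF bx(2)] by simp
    moreover have "(b x / x)\<^sup>2 \<le> stieltjes F x / stieltjes F (b x)"
    proof -
      have "(b x / x)\<^sup>2 * stieltjes F (b x) \<le> (b x / x)\<^sup>2 * ((x / b x)\<^sup>2 * stieltjes F x)"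
        using stieltjes_le_scaled[OF bx(2,1)] by (intro mult_left_mono) auto
      also have "\<dots> = stieltjes F x" using x bx by (simp add: power_divide)
      finally show ?thesis using pos[OF bx(2)] by (simp only: le_divide_eq if_True)
    qed
    ultimately show ?thesis by auto
  qed
  show "\<forall>\<^sub>F x in at_right 0. min 1 ((b x / x)\<^sup>2) \<le> stieltjes F x / stieltjes F (b x)"
    "\<forall>\<^sub>F x in at_right 0. stieltjes F x / stieltjes F (b x) \<le> max 1 ((b x / x)\<^sup>2)"
    using eventually_at_right_less[of "0::real"] by (eventually_elim, use * in blast)+
  have "((\<lambda>x. min 1 ((b x / x)\<^sup>2)) \<longlongrightarrow> min 1 (1\<^sup>2)) (at_right 0)"
    by (intro tendsto_intros lim)
  then show "((\<lambda>x. min 1 ((b x / x)\<^sup>2)) \<longlongrightarrow> 1) (at_right 0)" by simp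
  have "((\<lambda>x. max 1 ((b x / x)\<^sup>2)) \<longlongrightarrow> max 1 (1\<^sup>2)) (at_right 0)"
    by (intro tendsto_intros lim)
  then show "((\<lambda>x. max 1 ((b x / x)\<^sup>2)) \<longlongrightarrow> 1) (at_right 0)" by simp
qed

text \<open>On |t| \<le> x the kernel is at least 1/(2x^2). Later this makes the transform tend to
  infinity.\<close>

lemma specG_le_stieltjes:
  assumes "x > 0"
  shows "specG F x / (2 * x\<^sup>2) \<le> stieltjes F x"
proof -
  interpret finite_measure F by (rule finF)
  have "specG F x / (2 * x\<^sup>2) = (\<integral>t. indicator {-x..x} t / (2 * x\<^sup>2) \<partial>F)"
    by (simp add: specG_def setsF)
  also have "\<dots> \<le> stieltjes F x"
    unfolding stieltjes_def
  proof (rule integral_mono)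
    show "integrable F (\<lambda>t. indicator {-x..x} t / (2 * x\<^sup>2))"
      by (intro integrable_divide_zero integrable_real_indicator) (auto simp: setsF emeasure_eq_measure)
    fix t :: real
    show "indicator {-x..x} t / (2 * x\<^sup>2) \<le> 1 / (x\<^sup>2 + t\<^sup>2)"
    proof (cases "t \<in> {-x..x}")
      case True
      then have "t\<^sup>2 \<le> x\<^sup>2" by (auto simp flip: abs_le_square_iff)
      then show ?thesis using True assms by (auto intro!: frac_le simp: add_pos_nonneg)
    qed simp
  qed (rule stieltjes_kernel_integrable[OF finF setsF assms])
  finally show ?thesis .
qed

lemma fejer_integrable: "integrable F (fejer n)"
proof -
  interpret finite_measure F by (rule finF)
  show ?thesis by (rule integrable_const_bound[of _ "(real n)\<^sup>2"]) (auto simp: fejer_le)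
qed

lemma fejer_integral_bounds:
  "0 \<le> integral\<^sup>L F (fejer n)" "integral\<^sup>L F (fejer n) \<le> (real n)\<^sup>2 * measure F (space F)"
proof -
  interpret finite_measure F by (rule finF)
  show "0 \<le> integral\<^sup>L F (fejer n)" by (intro integral_nonneg_AE) simp
  have "integral\<^sup>L F (fejer n) \<le> (\<integral>t. (real n)\<^sup>2 \<partial>F)"
    by (intro integral_mono fejer_integrable fejer_le) auto
  then show "integral\<^sup>L F (fejer n) \<le> (real n)\<^sup>2 * measure F (space F)" by (simp add: mult.commute)
qed

lemma fejer_integral_exp_summable:
  assumes "\<delta> > 0"
  shows "summable (\<lambda>n. integral\<^sup>L F (fejer n) * exp (- (\<delta> * real n)))"
proof (rule summable_comparison_test')
  show "summable (\<lambda>n. measure F (space F) * ((real n)\<^sup>2 * exp (- (\<delta> * real n))))"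
    by (intro summable_mult summable_square_exp assms)
  show "norm (integral\<^sup>L F (fejer n) * exp (- (\<delta> * real n))) \<le> measure F (space F) * ((real n)\<^sup>2 * exp (- (\<delta> * real n)))" for n
    using mult_right_mono[OF fejer_integral_bounds(2)[of n], of "exp (- (\<delta> * real n))"] fejer_integral_bounds(1)[of n]
    by (simp add: abs_mult mult_ac)
qed

context
  assumes supp: "emeasure F (- {-pi..pi}) = 0"
begin

lemma AE_spectral_support: "AE t in F. \<bar>t\<bar> \<le> pi"
proof (rule AE_I)
  show "emeasure F (- {-pi..pi}) = 0" by (rule supp)
  show "{t \<in> space F. \<not> \<bar>t\<bar> \<le> pi} \<subseteq> - {-pi..pi}" by auto
  show "- {-pi..pi} \<in> sets F" by (simp add: setsF)
qed

lemma fejer_integral_sinc_bound: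
  "\<bar>integral\<^sup>L F (fejer n) - (\<integral>t. (real n)\<^sup>2 * sinc_sq (real n * t / 2) \<partial>F)\<bar> \<le> 4 * measure F (space F)"
proof -
  interpret finite_measure F by (rule finF)
  let ?w = "\<lambda>t. (real n)\<^sup>2 * sinc_sq (real n * t / 2)"
  have w: "integrable F ?w"
    by (rule integrable_const_bound[of _ "(real n)\<^sup>2"]) (auto simp: mult_left_le sinc_sq_le_1)
  have "\<bar>integral\<^sup>L F (fejer n) - integral\<^sup>L F ?w\<bar> = \<bar>\<integral>t. fejer n t - ?w t \<partial>F\<bar>"
    using fejer_integrable w by simp
  also have "\<dots> \<le> (\<integral>t. \<bar>fejer n t - ?w t\<bar> \<partial>F)" by (rule integral_abs_bound)
  also have "\<dots> \<le> (\<integral>t. 4 \<partial>F)"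
  proof (rule integral_mono_AE)
    show "AE t in F. \<bar>fejer n t - ?w t\<bar> \<le> 4"
      using AE_spectral_support by eventually_elim (rule fejer_sinc_bounds)
  qed (use fejer_integrable w in auto)
  finally show ?thesis by (simp add: mult.commute)
qed

lemma fejer_integral_generating_function:
  assumes "\<delta> > 0"
  shows "(\<Sum>n. integral\<^sup>L F (fejer n) * exp (- (\<delta> * real n)))
    = (1 + exp (- \<delta>)) / (1 - exp (- \<delta>)) * (\<integral>t. 1 / (laplace_scale \<delta> + 4 * (sin (t / 2))\<^sup>2) \<partial>F)"
proof -
  let ?f = "\<lambda>n t. fejer n t * exp (- (\<delta> * real n))"
  have "(\<integral>t. (\<Sum>n. ?f n t) \<partial>F) = (\<Sum>n. \<integral>t. ?f n t \<partial>F)"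
  proof (rule integral_suminf)
    show "integrable F (?f n)" for n using fejer_integrable by simp
    show "AE t in F. summable (\<lambda>n. norm (?f n t))"
      using fejer_exp_summable[OF assms] by (simp add: abs_mult)
    show "summable (\<lambda>n. \<integral>t. norm (?f n t) \<partial>F)"
      using fejer_integral_exp_summable[OF assms] by (simp add: abs_mult)
  qed
  moreover have "(\<integral>t. (\<Sum>n. ?f n t) \<partial>F)
      = (\<integral>t. (1 + exp (- \<delta>)) / (1 - exp (- \<delta>)) * (1 / (laplace_scale \<delta> + 4 * (sin (t / 2))\<^sup>2)) \<partial>F)"
  proof (rule integral_cong_AE)
    show "AE t in F. (\<Sum>n. ?f n t) = (1 + exp (- \<delta>)) / (1 - exp (- \<delta>)) * (1 / (laplace_scale \<delta> + 4 * (sin (t / 2))\<^sup>2))"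
      using AE_spectral_support by eventually_elim (rule fejer_generating_function[OF assms])
  qed measurable
  ultimately show ?thesis by (simp only: integral_mult_right_zero integral_mult_left_zero)
qed

text \<open>Dropping \<open>z\<close> from the denominators only enlarges the difference of the two
  kernels, and at z = 0 it is at most 1. The total mass is thus a bound independent of
  \<delta>.\<close>

lemma sin_resolvent_integral_bound:
  assumes "\<delta> > 0"
  shows "\<bar>(\<integral>t. 1 / (laplace_scale \<delta> + 4 * (sin (t / 2))\<^sup>2) \<partial>F) - stieltjes F (sqrt (laplace_scale \<delta>))\<bar> \<le> measure F (space F)"
proof -
  interpret finite_measure F by (rule finF)
  define z where "z = laplace_scale \<delta>"
  have z: "z > 0" using laplace_scale_pos[OF assms] by (simp add: z_def)
  let ?s = "\<lambda>t::real. 1 / (z + 4 * (sin (t / 2))\<^sup>2)" and ?p = "\<lambda>t::real. 1 / (z + t\<^sup>2)"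
  have s: "integrable F ?s"
    by (rule integrable_const_bound[of _ "1 / z"]) (use z in \<open>auto intro!: frac_le simp: abs_of_pos add_pos_nonneg\<close>)
  have p: "integrable F ?p"
    using stieltjes_kernel_integrable[OF finF setsF, of "sqrt z"] z by simp
  have "\<bar>integral\<^sup>L F ?s - integral\<^sup>L F ?p\<bar> = \<bar>\<integral>t. ?s t - ?p t \<partial>F\<bar>"
    using s p by simp
  also have "\<dots> \<le> (\<integral>t. \<bar>?s t - ?p t\<bar> \<partial>F)" by (rule integral_abs_bound)
  also have "\<dots> \<le> (\<integral>t. 1 \<partial>F)"
  proof (rule integral_mono_AE)
    show "AE t in F. \<bar>?s t - ?p t\<bar> \<le> 1"
      using AE_spectral_support
    proof eventually_elim
      case (elim t)
      show ?case
      proof (cases "t = 0")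
        case False
        define q where "q = 4 * (sin (t / 2))\<^sup>2"
        have q: "0 < q" "q \<le> t\<^sup>2" "1 / q - 1 / t\<^sup>2 \<le> 1"
          using sin_half_sq_bounds[OF False elim] by (simp_all only: q_def)
        have t: "t\<^sup>2 > 0" using False by simp
        have "1 / (z + q) - 1 / (z + t\<^sup>2) = (t\<^sup>2 - q) / ((z + q) * (z + t\<^sup>2))"
          using z q t by (simp add: field_simps)
        also have "\<dots> \<le> (t\<^sup>2 - q) / (q * t\<^sup>2)"
          using z q t by (intro divide_left_mono mult_mono mult_pos_pos) auto
        also have "\<dots> = 1 / q - 1 / t\<^sup>2" using q t by (simp add: field_simps)
        finally have "1 / (z + q) - 1 / (z + t\<^sup>2) \<le> 1" using q by linarith
        moreover have "0 \<le> 1 / (z + q) - 1 / (z + t\<^sup>2)" using z q by (simp add: frac_le)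
        ultimately show ?thesis by (simp add: q_def)
      qed simp
    qed
  qed (use s p in auto)
  finally show ?thesis using z by (simp add: stieltjes_def z_def[symmetric])
qed

end

end

section \<open>Abelian and Tauberian theorems for the spectral measure\<close>

lemma filterlim_one_div_at_right: "filterlim (\<lambda>x::real. 1 / x) at_top (at_right 0)"
  by real_asymp

lemma slowly_varying_scaled_reciprocal:
  assumes "slowly_varying L" "c > 0"
  shows "((\<lambda>x. L (1 / (c * x)) / L (1 / x)) \<longlongrightarrow> 1) (at_right 0)"
proof -
  have "((\<lambda>X. L (1 / c * X) / L X) \<longlongrightarrow> 1) at_top"
    using assms(1)[unfolded slowly_varying_def, THEN conjunct2, rule_format, of "1 / c"] assms(2) by simp
  from filterlim_compose[OF this filterlim_one_div_at_right] show ?thesis by simp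
qed

text \<open>The slowly varying factor cancels in the quotient, as does the nonzero constant
  \<open>k\<close>.\<close>

lemma regular_variation_of_limit:
  assumes L: "slowly_varying L" and "c > 0"
    and f: "((\<lambda>x. f x / (x powr \<alpha> * L (1 / x))) \<longlongrightarrow> k) (at_right 0)" and k: "k \<noteq> 0"
  shows "((\<lambda>x. f (c * x) / f x) \<longlongrightarrow> c powr \<alpha>) (at_right 0)"
proof -
  let ?r = "\<lambda>x. f x / (x powr \<alpha> * L (1 / x))"
  have Lpos: "L x > 0" if "x > 0" for x using L that by (simp add: slowly_varying_def)
  have "filterlim (\<lambda>x. c * x) (at_right 0) (at_right (0::real))"
    using \<open>c > 0\<close> by real_asymp
  from filterlim_compose[OF f this]
  have "((\<lambda>x. ?r (c * x) / ?r x * (c powr \<alpha> * (L (1 / (c * x)) / L (1 / x)))) \<longlongrightarrow> k / k * (c powr \<alpha> * 1)) (at_right 0)"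
    by (intro tendsto_mult tendsto_divide f k tendsto_const slowly_varying_scaled_reciprocal assms)
  then have "((\<lambda>x. ?r (c * x) / ?r x * (c powr \<alpha> * (L (1 / (c * x)) / L (1 / x)))) \<longlongrightarrow> c powr \<alpha>) (at_right 0)"
    using k by simp
  then show ?thesis
  proof (rule Lim_transform_eventually)
    show "\<forall>\<^sub>F x in at_right 0. ?r (c * x) / ?r x * (c powr \<alpha> * (L (1 / (c * x)) / L (1 / x))) = f (c * x) / f x"
      using eventually_at_right_less[of "0::real"]
    proof eventually_elim
      case (elim x)
      have "L (1 / x) \<noteq> 0" "L (1 / (c * x)) \<noteq> 0" using Lpos[of "1 / x"] Lpos[of "1 / (c * x)"] elim \<open>c > 0\<close> by auto
      then show ?case using elim \<open>c > 0\<close> by (simp add: powr_mult field_simps)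
    qed
  qed
qed

lemma powr_split_div:
  fixes x g \<gamma> :: real
  assumes "x > 0"
  shows "g / (x powr (2 - \<gamma>) * l) = g / (x\<^sup>2 * (x powr (- \<gamma>) * l))"
  using assms powr_add[of x 2 "- \<gamma>"] by (simp add: mult.assoc)

context
  fixes L :: "real \<Rightarrow> real"
  assumes L_meas: "L \<in> borel_measurable (restrict_space borel {0<..})"
    and L_sv: "slowly_varying L"
begin

lemma powr_neg_slowly_varying_at_top:
  assumes "\<gamma> > 0"
  shows "filterlim (\<lambda>x. x powr (- \<gamma>) * L (1 / x)) at_top (at_right 0)"
proof -
  have "filterlim (\<lambda>x. (1 / x) powr \<gamma> * L (1 / x)) at_top (at_right 0)"
    by (rule filterlim_compose[OF slowly_varying_powr_at_top[OF L_meas L_sv assms] filterlim_one_div_at_right])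
  then show ?thesis
    by (rule filterlim_cong[THEN iffD1, rotated -1])
       (auto intro!: eventually_mono[OF eventually_at_right_less[of "0::real"]] simp: powr_divide powr_minus_divide)
qed

context
  fixes F :: "real measure" and \<gamma> :: real
  assumes finF: "finite_measure F" and setsF [measurable_cong]: "sets F = sets borel"
    and supp: "emeasure F (- {-pi..pi}) = 0"
    and \<gamma>: "0 < \<gamma>" "\<gamma> < 2"
begin

text \<open>Chain of replacements: the Laplace sum at X = 1/x, its closed form \<open>P'\<close>,
  the transform at \<open>b x\<close>, and finally the transform at \<open>x\<close>.\<close>

lemma stieltjes_of_fejer_asymptotics:
  assumes K: "K > 0"
    and lim: "(\<lambda>n. integral\<^sup>L F (fejer n) / (real n powr \<gamma> * L (real n))) \<longlonglongrightarrow> K"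
  shows "((\<lambda>x. stieltjes F x / (x powr (- \<gamma>) * L (1 / x))) \<longlongrightarrow> K * Gamma (1 + \<gamma>) / 2) (at_right 0)"
proof -
  define T where "T = measure F (space F)"
  define q where "q x = x powr (- \<gamma>) * L (1 / x)" for x
  define A where "A x = (\<Sum>n. integral\<^sup>L F (fejer n) * exp (- (x * real n)))" for x
  define P' where "P' x = (\<integral>t. 1 / (laplace_scale x + 4 * (sin (t / 2))\<^sup>2) \<partial>F)" for x
  define b where "b x = sqrt (laplace_scale x)" for x
  define \<kappa> where "\<kappa> = K * Gamma (1 + \<gamma>) / 2"
  have \<kappa>: "\<kappa> > 0" using K \<gamma> by (simp add: \<kappa>_def)
  have qpos: "q x > 0" if "x > 0" for x
    using that slowly_varying_pos[OF L_sv] by (simp add: q_def)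
  have "((\<lambda>X. (\<Sum>n. integral\<^sup>L F (fejer n) * exp (- (real n / X))) / (X powr (\<gamma> + 1) * L X)) \<longlongrightarrow> K * Gamma (1 + \<gamma>)) at_top"
  proof (rule Abelian_Laplace_sum[OF L_meas L_sv _ lim \<gamma>(1)])
    show "0 \<le> integral\<^sup>L F (fejer n)" for n by (rule fejer_integral_bounds[OF finF setsF])
    show "summable (\<lambda>n. integral\<^sup>L F (fejer n) * exp (- (real n / X)))" if "X > 0" for X
      using fejer_integral_exp_summable[OF finF setsF, of "1 / X"] that by simp
  qed
  from filterlim_compose[OF this filterlim_one_div_at_right]
  have A: "((\<lambda>x. A x / ((1 / x) powr (\<gamma> + 1) * L (1 / x))) \<longlongrightarrow> K * Gamma (1 + \<gamma>)) (at_right 0)"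
    by (simp add: A_def mult.commute)
  \<comment> \<open>This is tanh(x/2)/x, the reciprocal of the prefactor of the generating function
    after scaling; it is the source of the 1/2 in \<open>\<kappa>\<close>.\<close>
  have h: "((\<lambda>x::real. (1 - exp (- x)) / (x * (1 + exp (- x)))) \<longlongrightarrow> 1 / 2) (at_right 0)"
    by real_asymp
  have "((\<lambda>x. A x / ((1 / x) powr (\<gamma> + 1) * L (1 / x)) * ((1 - exp (- x)) / (x * (1 + exp (- x))))) \<longlongrightarrow> \<kappa>) (at_right 0)"
    using tendsto_mult[OF A h] by (simp add: \<kappa>_def)
  moreover have "\<forall>\<^sub>F x in at_right 0. A x / ((1 / x) powr (\<gamma> + 1) * L (1 / x)) * ((1 - exp (- x)) / (x * (1 + exp (- x)))) = P' x / q x"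
    using eventually_at_right_less[of "0::real"]
  proof eventually_elim
    case (elim x)
    have "A x = (1 + exp (- x)) / (1 - exp (- x)) * P' x"
      unfolding A_def P'_def by (rule fejer_integral_generating_function[OF finF setsF supp elim])
    moreover have "1 - exp (- x) > 0" "1 + exp (- x) > 0" using elim by (auto simp: add_pos_pos)
    moreover have "(1 / x) powr (\<gamma> + 1) * L (1 / x) = q x / x"
      using elim by (simp add: q_def powr_divide powr_minus_divide powr_add)
    moreover have "(d / c * p) / (y / x) * (c / (x * d)) = p / y" if "c > 0" "d > 0" "y > 0" for c d p y
      using that elim by (simp add: field_simps)
    ultimately show ?case using qpos[OF elim] by (simp only:)
  qed
  ultimately have P'_lim: "((\<lambda>x. P' x / q x) \<longlongrightarrow> \<kappa>) (at_right 0)"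
    by (rule Lim_transform_eventually)
  \<comment> \<open>Replacing the sine by \<open>t\<close> costs at most the total mass, which
    vanishes relative to the normalizer.\<close>
  have "((\<lambda>x. T / q x) \<longlongrightarrow> 0) (at_right 0)"
    unfolding q_def by (intro tendsto_divide_0[OF tendsto_const] filterlim_at_top_imp_at_infinity powr_neg_slowly_varying_at_top \<gamma>)
  moreover have "\<forall>\<^sub>F x in at_right 0. norm (P' x / q x - stieltjes F (b x) / q x) \<le> T / q x"
    using eventually_at_right_less[of "0::real"]
  proof eventually_elim
    case (elim x)
    have "\<bar>P' x - stieltjes F (b x)\<bar> \<le> T"
      unfolding P'_def b_def T_def by (rule sin_resolvent_integral_bound[OF finF setsF supp elim])
    then show ?case using qpos[OF elim]
      by (simp add: diff_divide_distrib[symmetric] abs_divide divide_right_mono)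
  qed
  ultimately have "((\<lambda>x. P' x / q x - stieltjes F (b x) / q x) \<longlongrightarrow> 0) (at_right 0)"
    by (rule Lim_null_comparison[rotated])
  from tendsto_diff[OF P'_lim this]
  have Pb: "((\<lambda>x. stieltjes F (b x) / q x) \<longlongrightarrow> \<kappa>) (at_right 0)" by simp
  have bpos: "b x > 0" if "x > 0" for x using laplace_scale_pos[OF that] by (simp add: b_def)
  have "\<exists>x>0. stieltjes F x \<noteq> 0"
  proof (rule ccontr)
    assume *: "\<not> ?thesis"
    have "\<forall>\<^sub>F x in at_right 0. stieltjes F (b x) / q x = 0"
      using eventually_at_right_less[of "0::real"] by eventually_elim (use * bpos in auto)
    then have "((\<lambda>x. stieltjes F (b x) / q x) \<longlongrightarrow> 0) (at_right 0)"
      by (rule tendsto_eventually)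
    from tendsto_unique[OF _ this Pb] show False using \<kappa> by simp
  qed
  then have pos: "stieltjes F x > 0" if "x > 0" for x
    using stieltjes_pos[OF finF setsF] that by blast
  have "((\<lambda>x. b x / x) \<longlongrightarrow> 1) (at_right 0)"
    unfolding b_def laplace_scale_def by real_asymp
  then have "((\<lambda>x. stieltjes F x / stieltjes F (b x)) \<longlongrightarrow> 1) (at_right 0)"
    by (intro stieltjes_asymp_arg[OF finF setsF] bpos pos)
  from tendsto_mult[OF this Pb]
  have "((\<lambda>x. stieltjes F x / stieltjes F (b x) * (stieltjes F (b x) / q x)) \<longlongrightarrow> \<kappa>) (at_right 0)" by simp
  moreover have "\<forall>\<^sub>F x in at_right 0. stieltjes F x / stieltjes F (b x) * (stieltjes F (b x) / q x) = stieltjes F x / q x"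
    using eventually_at_right_less[of "0::real"]
  proof eventually_elim
    case (elim x)
    then show ?case using pos[OF bpos[OF elim]] by simp
  qed
  ultimately have "((\<lambda>x. stieltjes F x / q x) \<longlongrightarrow> \<kappa>) (at_right 0)"
    by (rule Lim_transform_eventually)
  then show ?thesis by (simp add: q_def \<kappa>_def)
qed

text \<open>The transform cancels between the limit of \<open>specG\<close> over it and its own
  asymptotics; the two constants multiply to \<open>Cgamma \<gamma> * K\<close>.\<close>

lemma specG_of_fejer_asymptotics:
  assumes K: "K > 0"
    and lim: "(\<lambda>n. integral\<^sup>L F (fejer n) / (real n powr \<gamma> * L (real n))) \<longlonglongrightarrow> K"
  shows "((\<lambda>x. specG F x / (x powr (2 - \<gamma>) * L (1 / x))) \<longlongrightarrow> Cgamma \<gamma> * K) (at_right 0)"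
proof -
  let ?q = "\<lambda>x. x powr (- \<gamma>) * L (1 / x)"
  note P = stieltjes_of_fejer_asymptotics[OF assms]
  have k: "K * Gamma (1 + \<gamma>) / 2 > 0" using K \<gamma> by simp
  have rv: "((\<lambda>x. stieltjes F (c * x) / stieltjes F x) \<longlongrightarrow> c powr (- \<gamma>)) (at_right 0)" if "c > 0" for c
    using k by (intro regular_variation_of_limit[OF L_sv that P]) auto
  from tendsto_mult[OF specG_div_stieltjes_limit[OF finF setsF \<gamma> rv] P]
  have "((\<lambda>x. specG F x / (x\<^sup>2 * stieltjes F x) * (stieltjes F x / ?q x))
      \<longlongrightarrow> sin (\<gamma> * pi / 2) / (pi * (1 - \<gamma> / 2)) * (K * Gamma (1 + \<gamma>) / 2)) (at_right 0)" .
  also have "sin (\<gamma> * pi / 2) / (pi * (1 - \<gamma> / 2)) * (K * Gamma (1 + \<gamma>) / 2) = Cgamma \<gamma> * K"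
    using \<gamma> by (simp add: Cgamma_def field_simps)
  finally show ?thesis
  proof (rule Lim_transform_eventually)
    have "\<forall>\<^sub>F x in at_right 0. stieltjes F x / ?q x > 0"
      using order_tendstoD(1)[OF P k] .
    then show "\<forall>\<^sub>F x in at_right 0. specG F x / (x\<^sup>2 * stieltjes F x) * (stieltjes F x / ?q x) = specG F x / (x powr (2 - \<gamma>) * L (1 / x))"
      using eventually_at_right_less[of "0::real"]
    proof eventually_elim
      case (elim x)
      then show ?case by (auto simp: powr_split_div)
    qed
  qed
qed

text \<open>Supplies a positive limit whose value is identified afterwards. Regular variation of the
  transform gives both \<open>specG\<close> and the sinc integral as multiples of it, so their ratio
  converges.\<close>

lemma fejer_of_specG_asymptotics:
  assumes k: "k > 0"
    and lim: "((\<lambda>x. specG F x / (x powr (2 - \<gamma>) * L (1 / x))) \<longlongrightarrow> k) (at_right 0)"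
  shows "\<exists>D>0. (\<lambda>n. integral\<^sup>L F (fejer n) / (real n powr \<gamma> * L (real n))) \<longlonglongrightarrow> D"
proof -
  define q where "q x = x powr (- \<gamma>) * L (1 / x)" for x
  have qpos: "q x > 0" if "x > 0" for x
    using that slowly_varying_pos[OF L_sv] by (simp add: q_def)
  have q_top: "filterlim q at_top (at_right 0)"
    unfolding q_def by (rule powr_neg_slowly_varying_at_top[OF \<gamma>(1)])
  have G: "((\<lambda>x. specG F x / (x\<^sup>2 * q x)) \<longlongrightarrow> k) (at_right 0)"
    by (rule Lim_transform_eventually[OF lim eventually_mono[OF eventually_at_right_less[of 0]]])
       (simp only: powr_split_div q_def)
  have "filterlim (\<lambda>x. specG F x / (x\<^sup>2 * q x) / 2 * q x) at_top (at_right 0)"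
    by (rule filterlim_tendsto_pos_mult_at_top[OF tendsto_divide[OF G tendsto_const] _ q_top]) (use k in auto)
  then have infty: "filterlim (stieltjes F) at_top (at_right 0)"
  proof (rule filterlim_at_top_mono)
    show "\<forall>\<^sub>F x in at_right 0. specG F x / (x\<^sup>2 * q x) / 2 * q x \<le> stieltjes F x"
      using eventually_at_right_less[of "0::real"]
    proof eventually_elim
      case (elim x)
      then show ?case using specG_le_stieltjes[OF finF setsF elim] qpos[OF elim] by (simp add: mult_ac)
    qed
  qed
  have rvG: "((\<lambda>y. specG F (c * y) / specG F y) \<longlongrightarrow> c powr (2 - \<gamma>)) (at_right 0)" if "c > 0" for c
    using k by (intro regular_variation_of_limit[OF L_sv that lim]) auto
  have rv: "((\<lambda>x. stieltjes F (c * x) / stieltjes F x) \<longlongrightarrow> c powr (- \<gamma>)) (at_right 0)" if "c > 0" for c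
    using specG_regular_variation_imp_stieltjes[OF finF setsF rvG infty that] by simp
  define \<sigma> where "\<sigma> = sin (\<gamma> * pi / 2) / (pi * (1 - \<gamma> / 2))"
  have \<sigma>: "\<sigma> > 0"
    unfolding \<sigma>_def using \<gamma> by (intro divide_pos_pos mult_pos_pos sin_gt_zero) auto
  have GP: "((\<lambda>x. specG F x / (x\<^sup>2 * stieltjes F x)) \<longlongrightarrow> \<sigma>) (at_right 0)"
    unfolding \<sigma>_def by (rule specG_div_stieltjes_limit[OF finF setsF \<gamma> rv])
  define D0 where "D0 = integral\<^sup>L (beta_dist (\<gamma> / 2)) fejer_profile"
  have D0: "D0 > 0" unfolding D0_def using \<gamma> by (intro fejer_profile_beta_integral_pos) auto
  define W where "W x = (\<integral>t. sinc_sq (t / (2 * x)) / x\<^sup>2 \<partial>F)" for x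
  have WP: "((\<lambda>x. W x / stieltjes F x) \<longlongrightarrow> D0) (at_right 0)"
    unfolding W_def D0_def by (rule fejer_div_stieltjes_limit[OF finF setsF \<gamma> rv])
  \<comment> \<open>The asymptotics of the transform relative to \<open>q\<close> enter as the
    quotient of the two limits \<open>G\<close> and \<open>GP\<close>.\<close>
  have "((\<lambda>x. W x / stieltjes F x * (specG F x / (x\<^sup>2 * q x) / (specG F x / (x\<^sup>2 * stieltjes F x)))) \<longlongrightarrow> D0 * (k / \<sigma>)) (at_right 0)"
    using \<sigma> by (intro tendsto_mult tendsto_divide WP G GP) auto
  moreover have "\<forall>\<^sub>F x in at_right 0. W x / stieltjes F x * (specG F x / (x\<^sup>2 * q x) / (specG F x / (x\<^sup>2 * stieltjes F x))) = W x / q x"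
    using eventually_at_right_less[of "0::real"] order_tendstoD(1)[OF GP \<sigma>]
  proof eventually_elim
    case (elim x)
    then have "specG F x \<noteq> 0" "stieltjes F x \<noteq> 0" by auto
    then show ?case using elim(1) qpos[OF elim(1)] by (simp add: field_simps)
  qed
  ultimately have "((\<lambda>x. W x / q x) \<longlongrightarrow> D0 * (k / \<sigma>)) (at_right 0)"
    by (rule Lim_transform_eventually)
  moreover have inv: "filterlim (\<lambda>n. 1 / real n) (at_right 0) sequentially"
    by real_asymp
  ultimately have Wn: "(\<lambda>n. W (1 / real n) / q (1 / real n)) \<longlonglongrightarrow> D0 * (k / \<sigma>)"
    by (rule filterlim_compose)
  define T where "T = measure F (space F)"
  \<comment> \<open>The bounded difference between the true Fejer kernel and its scale-invariant
    version is negligible after normalization.\<close>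
  have "(\<lambda>n. 4 * T / q (1 / real n)) \<longlonglongrightarrow> 0"
    by (intro tendsto_divide_0[OF tendsto_const] filterlim_at_top_imp_at_infinity filterlim_compose[OF q_top inv])
  moreover have "\<forall>\<^sub>F n in sequentially. norm (integral\<^sup>L F (fejer n) / q (1 / real n) - W (1 / real n) / q (1 / real n)) \<le> 4 * T / q (1 / real n)"
    using eventually_gt_at_top[of 0]
  proof eventually_elim
    case (elim n)
    have "W (1 / real n) = (\<integral>t. (real n)\<^sup>2 * sinc_sq (real n * t / 2) \<partial>F)"
      unfolding W_def by (intro Bochner_Integration.integral_cong) (auto simp: power_divide mult_ac)
    then have "\<bar>integral\<^sup>L F (fejer n) - W (1 / real n)\<bar> \<le> 4 * T"
      using fejer_integral_sinc_bound[OF finF setsF supp, of n] by (simp only: T_def)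
    then show ?case using qpos[of "1 / real n"] elim
      by (simp add: diff_divide_distrib[symmetric] abs_divide divide_right_mono)
  qed
  ultimately have "(\<lambda>n. integral\<^sup>L F (fejer n) / q (1 / real n) - W (1 / real n) / q (1 / real n)) \<longlonglongrightarrow> 0"
    by (rule Lim_null_comparison[rotated])
  from tendsto_add[OF this Wn]
  have "(\<lambda>n. integral\<^sup>L F (fejer n) / q (1 / real n)) \<longlonglongrightarrow> D0 * (k / \<sigma>)" by simp
  moreover have "q (1 / real n) = real n powr \<gamma> * L (real n)" for n
    by (simp add: q_def powr_divide powr_minus_divide)
  ultimately show ?thesis using D0 k \<sigma> by (intro exI[of _ "D0 * (k / \<sigma>)"]) simp
qed

text \<open>
  The constant in the Abelian direction is not computed from the Mellin transform of the
  Fejer kernel: applying the Tauberian direction to the limit \<open>D\<close> identifies it.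
\<close>

lemma specG_iff_fejer_asymptotics:
  assumes K: "K > 0"
  shows "((\<lambda>x. specG F x / (x powr (2 - \<gamma>) * L (1 / x))) \<longlongrightarrow> Cgamma \<gamma> * K) (at_right 0)
    \<longleftrightarrow> (\<lambda>n. integral\<^sup>L F (fejer n) / (real n powr \<gamma> * L (real n))) \<longlonglongrightarrow> K"
proof
  assume G: "((\<lambda>x. specG F x / (x powr (2 - \<gamma>) * L (1 / x))) \<longlongrightarrow> Cgamma \<gamma> * K) (at_right 0)"
  have C: "Cgamma \<gamma> > 0"
    unfolding Cgamma_def using \<gamma> by (intro divide_pos_pos mult_pos_pos sin_gt_zero) auto
  obtain D where D: "D > 0" "(\<lambda>n. integral\<^sup>L F (fejer n) / (real n powr \<gamma> * L (real n))) \<longlonglongrightarrow> D"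
    using fejer_of_specG_asymptotics[OF _ G] C K by auto
  have "Cgamma \<gamma> * D = Cgamma \<gamma> * K"
    by (rule tendsto_unique[OF _ specG_of_fejer_asymptotics[OF D] G]) simp
  then show "(\<lambda>n. integral\<^sup>L F (fejer n) / (real n powr \<gamma> * L (real n))) \<longlonglongrightarrow> K"
    using C D(2) by simp
qed (rule specG_of_fejer_asymptotics[OF K])

end

end

section \<open>The variance as a Fejer integral, and the equivalences for the process\<close>

lemma variance_sum_eq_fejer_integral:
  fixes M :: "'a measure" and X :: "nat \<Rightarrow> 'a \<Rightarrow> real" and F :: "real measure"
  assumes M: "prob_space M"
    and X_meas: "\<And>i. X i \<in> borel_measurable M"
    and X_sq: "\<And>i. integrable M (\<lambda>\<omega>. (X i \<omega>)\<^sup>2)"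
    and X_mean: "\<And>i. integral\<^sup>L M (X i) = 0"
    and finF: "finite_measure F" and setsF [measurable_cong]: "sets F = sets borel"
    and cov: "\<And>j k. complex_of_real (covariance M (X j) (X k)) = spec_coeff F (int k - int j)"
  shows "prob_space.variance M (\<lambda>\<omega>. \<Sum>i\<in>{1..n}. X i \<omega>) = integral\<^sup>L F (fejer n)"
proof -
  interpret M: prob_space M by (rule M)
  interpret F: finite_measure F by (rule finF)
  have X_int: "integrable M (X i)" for i
    using M.square_integrable_imp_integrable[OF X_meas X_sq] .
  have XX: "integrable M (\<lambda>\<omega>. X i \<omega> * X j \<omega>)" for i j
  proof (rule Bochner_Integration.integrable_bound[OF Bochner_Integration.integrable_add[OF X_sq[of i] X_sq[of j]]])
    have "\<bar>a * b\<bar> \<le> a\<^sup>2 + b\<^sup>2" for a b :: real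
    proof -
      have "2 * (\<bar>a\<bar> * \<bar>b\<bar>) \<le> a\<^sup>2 + b\<^sup>2" using sum_squares_bound[of "\<bar>a\<bar>" "\<bar>b\<bar>"] by simp
      moreover have "0 \<le> \<bar>a\<bar> * \<bar>b\<bar>" by simp
      ultimately show ?thesis unfolding abs_mult by linarith
    qed
    then show "AE \<omega> in M. norm (X i \<omega> * X j \<omega>) \<le> norm ((X i \<omega>)\<^sup>2 + (X j \<omega>)\<^sup>2)" by simp
  qed (use X_meas in measurable)
  have mean: "M.expectation (\<lambda>\<omega>. \<Sum>i\<in>{1..n}. X i \<omega>) = 0"
    using X_int X_mean by simp
  have "M.variance (\<lambda>\<omega>. \<Sum>i\<in>{1..n}. X i \<omega>) = (\<integral>\<omega>. (\<Sum>j\<in>{1..n}. \<Sum>k\<in>{1..n}. X j \<omega> * X k \<omega>) \<partial>M)"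
    unfolding mean by (simp add: power2_eq_square sum_product)
  also have "\<dots> = (\<Sum>j\<in>{1..n}. \<Sum>k\<in>{1..n}. covariance M (X j) (X k))"
    using XX by (simp add: covariance_def X_mean)
  finally have "complex_of_real (M.variance (\<lambda>\<omega>. \<Sum>i\<in>{1..n}. X i \<omega>)) = (\<Sum>j\<in>{1..n}. \<Sum>k\<in>{1..n}. spec_coeff F (int k - int j))"
    by (simp add: cov)
  also have "\<dots> = (CLINT t|F. (\<Sum>j\<in>{1..n}. \<Sum>k\<in>{1..n}. exp (\<i> * complex_of_real t * of_int (int k - int j))))"
  proof -
    have "complex_integrable F (\<lambda>t. exp (\<i> * complex_of_real t * of_int m))" for m
      by (rule F.integrable_const_bound[of _ 1]) (auto simp: norm_exp_eq_Re)
    then show ?thesis by (simp add: spec_coeff_def del: of_int_diff)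
  qed
  also have "\<dots> = (CLINT t|F. complex_of_real (fejer n t))"
  proof (rule Bochner_Integration.integral_cong)
    fix t :: real
    let ?e = "\<lambda>k::nat. exp (\<i> * complex_of_real t * of_nat k)"
    \<comment> \<open>The dependence on k - j factors, so the double sum is a product of conjugate
      exponential sums, a squared modulus.\<close>
    have "exp (\<i> * complex_of_real t * of_int (int k - int j)) = cnj (?e j) * ?e k" for j k
      by (simp add: exp_cnj mult_exp_exp algebra_simps)
    then have "(\<Sum>j\<in>{1..n}. \<Sum>k\<in>{1..n}. exp (\<i> * complex_of_real t * of_int (int k - int j))) = cnj (\<Sum>j\<in>{1..n}. ?e j) * (\<Sum>k\<in>{1..n}. ?e k)"
      by (simp add: sum_product)
    also have "\<dots> = complex_of_real (fejer n t)"
      unfolding fejer_def by (subst mult.commute) (rule complex_norm_square[symmetric])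
    finally show "(\<Sum>j\<in>{1..n}. \<Sum>k\<in>{1..n}. exp (\<i> * complex_of_real t * of_int (int k - int j))) = complex_of_real (fejer n t)" .
  qed simp
  also have "\<dots> = complex_of_real (integral\<^sup>L F (fejer n))" by simp
  finally show ?thesis by (simp only: of_real_eq_iff)
qed

text \<open>Asymptotic equivalence counts 0/0 as 1, unlike plain division; eventual nonvanishing of
  \<open>g\<close> makes the two readings agree.\<close>

lemma asymp_equiv_const_mult_iff:
  fixes f g :: "'b \<Rightarrow> real"
  assumes "c \<noteq> 0" "\<forall>\<^sub>F x in A. g x \<noteq> 0"
  shows "f \<sim>[A] (\<lambda>x. c * g x) \<longleftrightarrow> ((\<lambda>x. f x / g x) \<longlongrightarrow> c) A"
proof -
  have "f \<sim>[A] (\<lambda>x. c * g x) \<longleftrightarrow> ((\<lambda>x. f x / (c * g x)) \<longlongrightarrow> 1) A"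
    unfolding asymp_equiv_def
    by (rule tendsto_cong) (use assms in \<open>auto elim!: eventually_mono\<close>)
  also have "\<dots> \<longleftrightarrow> ((\<lambda>x. f x / g x) \<longlongrightarrow> c) A"
  proof
    assume "((\<lambda>x. f x / (c * g x)) \<longlongrightarrow> 1) A"
    from tendsto_mult[OF tendsto_const[of c] this] show "((\<lambda>x. f x / g x) \<longlongrightarrow> c) A"
      using assms(1) by simp
  next
    assume "((\<lambda>x. f x / g x) \<longlongrightarrow> c) A"
    from tendsto_divide[OF this tendsto_const[of c]] show "((\<lambda>x. f x / (c * g x)) \<longlongrightarrow> 1) A"
      using assms(1) by (simp add: mult.commute)
  qed
  finally show ?thesis .
qed

theorem theorem1:
  fixes M :: "'a measure" and X :: "nat \<Rightarrow> 'a \<Rightarrow> real" and F :: "real measure"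
    and \<gamma> K0 :: real and L :: "real \<Rightarrow> real"
  assumes "prob_space M"
    and "\<And>i. X i \<in> borel_measurable M"
    and "\<And>i. integrable M (\<lambda>\<omega>. (X i \<omega>)\<^sup>2)"
    and "\<And>i. integral\<^sup>L M (X i) = 0"
    and "finite_measure F" and "sets F = sets borel"
    and "emeasure F (- {-pi..pi}) = 0"
    and "\<And>A. A \<in> sets borel \<Longrightarrow> emeasure F (uminus ` A) = emeasure F A"
    and "\<And>j k. complex_of_real (covariance M (X j) (X k)) = spec_coeff F (int k - int j)"
    and "0 < \<gamma>" and "\<gamma> < 2" and "K0 > 0"
    and "L \<in> borel_measurable (restrict_space borel {0<..})"
    and "slowly_varying L"
  shows "(((\<lambda>x. specG F x) \<sim>[at_right 0]
            (\<lambda>x. Cgamma \<gamma> * K0 * x powr (2 - \<gamma>) * L (1 / x)))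
         \<longleftrightarrow>
         ((\<lambda>n. prob_space.variance M (\<lambda>\<omega>. \<Sum>i\<in>{1..n}. X i \<omega>)) \<sim>[sequentially]
            (\<lambda>n. K0 * real n powr \<gamma> * L (real n))))
       \<and> (((\<lambda>n. prob_space.variance M (\<lambda>\<omega>. \<Sum>i\<in>{1..n}. X i \<omega>) / real n) \<longlonglongrightarrow> K0)
         \<longleftrightarrow> ((\<lambda>x. specG F x / x) \<longlongrightarrow> K0 / pi) (at_right 0))"
proof -
  note V = variance_sum_eq_fejer_integral[OF assms(1-6,9)]
  have Lpos: "L x > 0" if "x > 0" for x
    using slowly_varying_pos[OF assms(14) that] .
  have C: "Cgamma \<gamma> > 0"
    unfolding Cgamma_def using assms(10,11) by (intro divide_pos_pos mult_pos_pos sin_gt_zero) auto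
  have G_ne: "\<forall>\<^sub>F x in at_right 0. x powr (2 - \<gamma>) * L (1 / x) \<noteq> 0"
    using eventually_at_right_less[of "0::real"]
  proof eventually_elim
    case (elim x)
    then show ?case using Lpos[of "1 / x"] by simp
  qed
  have V_ne: "\<forall>\<^sub>F n in sequentially. real n powr \<gamma> * L (real n) \<noteq> 0"
    using eventually_gt_at_top[of 0]
  proof eventually_elim
    case (elim n)
    then show ?case using Lpos[of "real n"] by simp
  qed
  have "(\<lambda>x. specG F x) \<sim>[at_right 0] (\<lambda>x. Cgamma \<gamma> * K0 * (x powr (2 - \<gamma>) * L (1 / x)))
      \<longleftrightarrow> (\<lambda>n. integral\<^sup>L F (fejer n)) \<sim>[sequentially] (\<lambda>n. K0 * (real n powr \<gamma> * L (real n)))"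
  proof -
    have "(\<lambda>x. specG F x) \<sim>[at_right 0] (\<lambda>x. Cgamma \<gamma> * K0 * (x powr (2 - \<gamma>) * L (1 / x)))
        \<longleftrightarrow> ((\<lambda>x. specG F x / (x powr (2 - \<gamma>) * L (1 / x))) \<longlongrightarrow> Cgamma \<gamma> * K0) (at_right 0)"
      using C assms(12) by (intro asymp_equiv_const_mult_iff G_ne) auto
    moreover have "(\<lambda>n. integral\<^sup>L F (fejer n)) \<sim>[sequentially] (\<lambda>n. K0 * (real n powr \<gamma> * L (real n)))
        \<longleftrightarrow> (\<lambda>n. integral\<^sup>L F (fejer n) / (real n powr \<gamma> * L (real n))) \<longlonglongrightarrow> K0"
      using assms(12) by (intro asymp_equiv_const_mult_iff V_ne) auto
    ultimately show ?thesis
      using specG_iff_fejer_asymptotics[OF assms(13,14,5,6,7,10,11,12)] by (simp only:)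
  qed
  \<comment> \<open>The case \<gamma> = 1 with constant slowly varying factor 1, where
    \<open>Cgamma 1\<close> is 1/pi because \<open>Gamma 2 = 1\<close> and the sine is 1.\<close>
  moreover have "((\<lambda>x. specG F x / x) \<longlongrightarrow> K0 / pi) (at_right 0) \<longleftrightarrow> (\<lambda>n. integral\<^sup>L F (fejer n) / real n) \<longlonglongrightarrow> K0"
  proof -
    have sv: "slowly_varying (\<lambda>_. 1)" by (simp add: slowly_varying_def)
    have C1: "Cgamma 1 * K0 = K0 / pi"
      using Gamma_fact[of 1, where 'a = real] by (simp add: Cgamma_def)
    have "((\<lambda>x. specG F x / (x powr (2 - 1) * 1)) \<longlongrightarrow> Cgamma 1 * K0) (at_right 0)
      \<longleftrightarrow> (\<lambda>n. integral\<^sup>L F (fejer n) / (real n powr 1 * 1)) \<longlonglongrightarrow> K0"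
      by (rule specG_iff_fejer_asymptotics[OF _ sv assms(5,6,7) _ _ assms(12)]) auto
    moreover have "((\<lambda>x. specG F x / (x powr (2 - 1) * 1)) \<longlongrightarrow> Cgamma 1 * K0) (at_right 0)
        \<longleftrightarrow> ((\<lambda>x. specG F x / x) \<longlongrightarrow> K0 / pi) (at_right 0)"
      unfolding C1 by (rule tendsto_cong, rule eventually_mono[OF eventually_at_right_less[of 0]]) simp
    ultimately show ?thesis by simp
  qed
  ultimately show ?thesis unfolding V by (simp only: mult.assoc)
qed

end
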